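(* Let $r\ge 1$, $\alpha,\beta>-1$, let $H$ be as in the context, and let $W(x)=(1-x)^{\alpha}(1+x)^{\beta}H(x)$ for $x\in(-1,1)$. Then there exists an analytic matrix valued function $D:\mathbb C\setminus[-1,1]\to\mathbb C^{r\times r}$ such that $D(z)$ is invertible for every $z\in\mathbb C\setminus[-1,1]$, the limit $D(\infty)=\lim_{z\to\infty}D(z)$ exists and is invertible, and $D$ has boundary values $D_\pm(x)=\lim_{\varepsilon\to0+}D(x\pm i\varepsilon)$ on $(-1,1)$ satisfying \[W(x)=D_-(x)D_-(x)^\ast=D_+(x)D_+(x)^\ast,\qquad x\in(-1,1).\]
   Context: $H:[-1,1]\to\mathbb C^{r\times r}$ is a matrix valued function such that $H(x)$ is Hermitian positive definite for every $x\in(-1,1)$, $H$ is real analytic on $[-1,1]$ (it extends analytically to a complex neighborhood of $[-1,1]$), and neither $H(1)$ nor $H(-1)$ is the zero matrix. $A^\ast$ denotes the conjugate transpose of $A$. *)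

theory Defs
  imports "HOL-Complex_Analysis.Complex_Analysis"
begin

text \<open>Complex r x r matrices are represented as complex^'r^'r, r = CARD('r) \<ge> 1.\<close>

definition cadjoint :: "complex^'n^'m \<Rightarrow> complex^'m^'n" where
  "cadjoint A = (\<chi> i j. cnj (A $ j $ i))"

definition hermitian_mat :: "complex^'n^'n \<Rightarrow> bool" where
  "hermitian_mat A \<longleftrightarrow> cadjoint A = A"

definition pos_def_mat :: "complex^'n^'n \<Rightarrow> bool" where
  "pos_def_mat A \<longleftrightarrow> hermitian_mat A \<and>
     (\<forall>v::complex^'n. v \<noteq> 0 \<longrightarrow>
        (\<Sum>i\<in>UNIV. \<Sum>j\<in>UNIV. cnj (v $ i) * A $ i $ j * v $ j) \<in> \<real> \<and>
        Re (\<Sum>i\<in>UNIV. \<Sum>j\<in>UNIV. cnj (v $ i) * A $ i $ j * v $ j) > 0)"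

definition mat_analytic_on :: "(complex \<Rightarrow> complex^'n^'m) \<Rightarrow> complex set \<Rightarrow> bool" where
  "mat_analytic_on F S \<longleftrightarrow> (\<forall>i j. (\<lambda>z. F z $ i $ j) analytic_on S)"

definition real_analytic_mat_on_interval :: "(real \<Rightarrow> complex^'n^'m) \<Rightarrow> bool" where
  "real_analytic_mat_on_interval H \<longleftrightarrow>
     (\<exists>U G. open U \<and> complex_of_real ` {-1..1} \<subseteq> U \<and> mat_analytic_on G U \<and>
            (\<forall>x\<in>{-1..1}. G (complex_of_real x) = H x))"

end

theory Submission
  imports Defs
begin

text \<open>
  With \<open>z = (w + 1/w) / 2\<close>, \<open>norm w < 1\<close>, the scalar factor has the explicit Szego function
  \<open>2 powr (- (\<alpha> + \<beta>) / 2) * (1 - w) powr \<alpha> * (1 + w) powr \<beta>\<close>, and it remains to factor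
  \<open>F w = H (Re w)\<close> on the unit circle as \<open>S S*\<close> with \<open>S\<close> analytic on the closed disc and invertible
  inside.

  Suppose first that the analytic symbol \<open>F\<close> is positive definite on the whole circle. Then it is
  still accretive on a slightly larger circle, so the Toeplitz operator with symbol \<open>F\<close> on that
  circle is inverted by a Neumann series. This yields \<open>X\<close>, analytic on a neighbourhood of the
  closed disc, such that \<open>X F\<close> has only nonpositive frequencies and mean \<open>1\<close>. Its adjoint extends
  to an analytic \<open>K\<close> on the disc, and \<open>X K\<close>, which equals \<open>X F X*\<close> on the circle, is analytic and
  Hermitian there, hence a constant \<open>A = B B*\<close>. Then \<open>S = K (B*)^(-1)\<close> works.

  If \<open>F p\<close> is singular at a point \<open>p\<close> of the circle, move a kernel vector into a coordinate
  direction; the corresponding row and column can then be divided by \<open>w - p\<close> and its conjugate, the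
  diagonal entry having a double zero because it is nonnegative. This keeps \<open>F\<close> analytic and
  positive semidefinite and lowers the order of \<open>det F\<close> at \<open>p\<close> by two.
\<close>

text \<open>A half-line Toeplitz system solved with operator norms only gives a bounded coefficient
  sequence. Solving it on a circle of radius s > 1 and rescaling by s^k turns boundedness into
  geometric decay, so that X converges beyond the closed disc and no boundary theory is needed. On
  that circle F is in general not Hermitian, which is why positivity is carried as coercivity of the
  real inner product of A with A F: this is an open condition, and it is exactly what makes 1 - tau
  F a strict contraction for a small step tau. Zeros on the circle cannot be avoided, since H may
  degenerate at the endpoints of the interval, that is at w = 1 and w = -1. Removing them costs
  nothing inside: a factor w - p is singular only at p, so S stays invertible in the open disc,
  which is where the slit plane is mapped. The two sides of the cut correspond to the two arcs of
  the circle. At conjugate points F takes the same value H(x), which is why both boundary values of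
  D factor the same weight.\<close>

no_notation fps_nth (infixl "$" 75)

section \<open>Positive semidefinite complex matrices\<close>

lemma cadjoint_nth [simp]: "cadjoint A $ i $ j = cnj (A $ j $ i)"
  by (simp add: cadjoint_def)

lemma cadjoint_cadjoint [simp]: "cadjoint (cadjoint A) = A"
  by (simp add: vec_eq_iff)

lemma cadjoint_mult: "cadjoint (A ** B) = cadjoint B ** cadjoint A"
  by (simp add: vec_eq_iff matrix_matrix_mult_def mult.commute)

lemma cadjoint_mat_1 [simp]: "cadjoint (mat 1) = mat 1"
  by (simp add: vec_eq_iff mat_def)

lemma det_cadjoint: "det (cadjoint A) = cnj (det A)" for A :: "complex^'n^'n"
proof -
  have "det (cadjoint A) = det (\<chi> i j. cnj (A $ i $ j))"
    using det_transpose[of "cadjoint A"] by (simp add: transpose_def)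
  then show ?thesis
    by (simp add: det_def)
qed

definition hform :: "complex^'n^'n \<Rightarrow> complex^'n \<Rightarrow> complex" where
  "hform A v = (\<Sum>i\<in>UNIV. \<Sum>j\<in>UNIV. cnj (v $ i) * A $ i $ j * v $ j)"

text \<open>Only non-strict inequalities occur, so the notion is closed under limits. For a
  Hermitian matrix the form is real, hence testing the real part loses nothing.\<close>

definition psd :: "complex^'n^'n \<Rightarrow> bool" where
  "psd A \<longleftrightarrow> hermitian_mat A \<and> (\<forall>v. 0 \<le> Re (hform A v))"

lemma hermitian_matD: "hermitian_mat A \<Longrightarrow> cnj (A $ i $ j) = A $ j $ i"
  unfolding hermitian_mat_def by (metis cadjoint_nth)

lemma hform_eq_sum: "hform A v = (\<Sum>i\<in>UNIV. cnj (v $ i) * (A *v v) $ i)"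
  by (simp add: hform_def matrix_vector_mult_def sum_distrib_left mult.assoc)

text \<open>The adjoint relation for the inner product that is conjugate linear in its first
  argument.\<close>

lemma hform_swap: "(\<Sum>i\<in>UNIV. cnj ((V *v u) $ i) * w $ i) = (\<Sum>i\<in>UNIV. cnj (u $ i) * (cadjoint V *v w) $ i)"
  for V :: "complex^'n^'m"
  by (simp add: matrix_vector_mult_def sum_distrib_left sum_distrib_right mult_ac)
     (rule sum.swap)

lemma hform_congruence: "hform (cadjoint V ** A ** V) v = hform A (V *v v)"
  using hform_swap[of V v "A *v (V *v v)"]
  by (simp add: hform_eq_sum matrix_vector_mul_assoc matrix_mul_assoc)

lemma hermitian_congruence: "hermitian_mat A \<Longrightarrow> hermitian_mat (cadjoint V ** A ** V)"
  by (simp add: hermitian_mat_def cadjoint_mult matrix_mul_assoc)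

lemma psd_congruence: "psd A \<Longrightarrow> psd (cadjoint V ** A ** V)"
  by (simp add: psd_def hform_congruence hermitian_congruence)

lemma hform_real:
  assumes "hermitian_mat A"
  shows "hform A v \<in> \<real>"
proof -
  have "cnj (hform A v) = (\<Sum>i\<in>UNIV. \<Sum>j\<in>UNIV. v $ i * cnj (A $ i $ j) * cnj (v $ j))"
    by (simp add: hform_def)
  also have "\<dots> = (\<Sum>i\<in>UNIV. \<Sum>j\<in>UNIV. cnj (v $ j) * A $ j $ i * v $ i)"
    by (simp add: hermitian_matD[OF assms] mult_ac)
  also have "\<dots> = hform A v"
    unfolding hform_def by (rule sum.swap)
  finally show ?thesis
    by (simp add: Reals_cnj_iff)
qed

lemma hform_tendsto:
  assumes "(f \<longlongrightarrow> A) F"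
  shows "((\<lambda>x. hform (f x) v) \<longlongrightarrow> hform A v) F"
  unfolding hform_def by (intro tendsto_intros assms)

text \<open>Definiteness may be lost in a limit, semidefiniteness is not. This supplies the values
  at w = 1 and w = -1 and at a point where a zero has been divided out.\<close>

lemma psd_limit:
  assumes f: "(f \<longlongrightarrow> A) F" and ev: "\<forall>\<^sub>F x in F. psd (f x)" and F: "F \<noteq> bot"
  shows "psd A"
  unfolding psd_def
proof (intro conjI allI)
  have "cnj (A $ i $ j) = A $ j $ i" for i j
  proof (rule tendsto_unique[OF F])
    show "((\<lambda>x. cnj (f x $ i $ j)) \<longlongrightarrow> cnj (A $ i $ j)) F"
      by (intro tendsto_intros f)
    have "\<forall>\<^sub>F x in F. f x $ j $ i = cnj (f x $ i $ j)"
      using ev by eventually_elim (simp add: psd_def hermitian_matD)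
    moreover have "((\<lambda>x. f x $ j $ i) \<longlongrightarrow> A $ j $ i) F"
      by (intro tendsto_intros f)
    ultimately show "((\<lambda>x. cnj (f x $ i $ j)) \<longlongrightarrow> A $ j $ i) F"
      by (rule Lim_transform_eventually[rotated])
  qed
  then show "hermitian_mat A"
    by (simp add: hermitian_mat_def vec_eq_iff)
  fix v
  have "((\<lambda>x. Re (hform (f x) v)) \<longlongrightarrow> Re (hform A v)) F"
    by (intro tendsto_intros hform_tendsto f)
  then show "0 \<le> Re (hform A v)"
    by (rule tendsto_lowerbound[OF _ _ F]) (use ev in \<open>auto elim: eventually_mono simp: psd_def\<close>)
qed

lemma sum_cnj_mult_self: "(\<Sum>i\<in>UNIV. cnj (v $ i) * v $ i) = complex_of_real ((norm v)\<^sup>2)"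
  for v :: "complex^'n"
  by (simp add: norm_vec_def L2_set_def sum_nonneg mult.commute complex_norm_square del: of_real_power flip: of_real_power)

lemma quadratic_nonneg_imp_linear_zero:
  fixes a b :: real
  assumes "\<And>t. 0 \<le> t\<^sup>2 * a - 2 * t * b" and "0 \<le> b"
  shows "b = 0"
proof (rule ccontr)
  assume "b \<noteq> 0"
  with assms have b: "b > 0" by simp
  show False
  proof (cases "a > 0")
    case True
    \<comment> \<open>The minimiser of the quadratic in t.\<close>
    have "0 \<le> (b/a)\<^sup>2 * a - 2 * (b/a) * b" by (rule assms)
    also have "\<dots> = - (b\<^sup>2 / a)" using True by (simp add: power2_eq_square field_simps)
    finally show False using b True by (simp add: field_simps)
  next
    case False
    with assms(1)[of 1] b show False by simp
  qed
qed

text \<open>A zero of a nonnegative form is a minimum, so the first variation vanishes there. In the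
  direction -A v this variation is -2 |A v|^2.\<close>

lemma psd_hform_zero:
  assumes A: "psd A" and z: "hform A v = 0"
  shows "A *v v = 0"
proof -
  define u where "u = A *v v"
  have herm: "cadjoint A = A" using A by (simp add: psd_def hermitian_mat_def)
  have exp: "Re (hform A (v - t *\<^sub>R u)) = t\<^sup>2 * Re (hform A u) - 2 * t * (norm u)\<^sup>2" for t :: real
  proof -
    have 1: "(\<Sum>i\<in>UNIV. cnj (v $ i) * (A *v u) $ i) = complex_of_real ((norm u)\<^sup>2)"
      using hform_swap[of A v u] by (simp add: herm u_def[symmetric] sum_cnj_mult_self)
    have "hform A (v - t *\<^sub>R u) = (\<Sum>i\<in>UNIV. (cnj (v $ i) - t *\<^sub>R cnj (u $ i)) * (u $ i - t *\<^sub>R (A *v u) $ i))"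
      unfolding hform_eq_sum
      by (simp add: matrix_vector_mult_diff_distrib linear_scale[OF matrix_vector_mul_linear] u_def)
    also have "\<dots> = hform A v - t *\<^sub>R (\<Sum>i\<in>UNIV. cnj (v $ i) * (A *v u) $ i)
       - t *\<^sub>R (\<Sum>i\<in>UNIV. cnj (u $ i) * u $ i) + (t * t) *\<^sub>R hform A u"
      unfolding hform_eq_sum u_def[symmetric]
      by (simp add: algebra_simps sum.distrib sum_subtractf scaleR_sum_right)
    finally show ?thesis
      unfolding 1 z sum_cnj_mult_self by (simp add: power2_eq_square)
  qed
  have "(norm u)\<^sup>2 = 0"
    by (rule quadratic_nonneg_imp_linear_zero[of "Re (hform A u)"])
       (use A in \<open>auto simp: psd_def simp flip: exp\<close>)
  then show ?thesis by (simp add: u_def)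
qed

lemma psd_pos:
  assumes A: "psd A" and d: "invertible A" and v: "v \<noteq> 0"
  shows "0 < Re (hform A v)"
proof (rule ccontr)
  assume "\<not> ?thesis"
  with A have "Re (hform A v) = 0" by (auto simp: psd_def intro: antisym)
  moreover have "Im (hform A v) = 0" using hform_real[of A v] A by (simp add: psd_def complex_is_Real_iff)
  ultimately have "A *v v = 0" by (intro psd_hform_zero A) (simp add: complex_eq_iff)
  then show False using d v unfolding invertible_def
    by (metis matrix_vector_mul_assoc matrix_vector_mul_lid matrix_vector_mult_0_right)
qed

lemma matrix_vector_axis: "(A *v axis k 1) $ i = A $ i $ k" for A :: "complex^'n^'m"
  by (simp add: matrix_vector_mult_def axis_def if_distrib if_distribR cong: if_cong)

lemma hform_axis: "hform A (axis k 1) = A $ k $ k"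
proof -
  have "hform A (axis k 1) = (\<Sum>i\<in>UNIV. if i = k then A $ i $ k else 0)"
    unfolding hform_eq_sum matrix_vector_axis by (rule sum.cong) (auto simp: axis_def)
  then show ?thesis by simp
qed

lemma psd_diagonal:
  assumes "psd A"
  shows "A $ k $ k \<in> \<real>" "0 \<le> Re (A $ k $ k)"
  using assms hform_real[of A "axis k 1"] unfolding psd_def hform_axis[symmetric] by auto

lemma psd_diagonal_zero:
  assumes "psd A" "A $ k $ k = 0"
  shows "A $ i $ k = 0" "A $ k $ i = 0"
proof -
  have "A *v axis k 1 = 0" by (intro psd_hform_zero) (use assms in \<open>auto simp: hform_axis\<close>)
  then show 1: "A $ i $ k = 0" using matrix_vector_axis[of A k i] by simp
  have "cnj (A $ i $ k) = A $ k $ i" using assms by (simp add: psd_def hermitian_matD)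
  with 1 show "A $ k $ i = 0" by simp
qed

text \<open>Right multiplication by \<open>V\<close> subtracts multiples of column k from every
  column, column k included, and produces the Schur complement. Its row k is zero, so
  \<open>cadjoint V\<close> on the left changes nothing and the Schur complement is a congruence of
  A.\<close>

lemma psd_schur_complement:
  assumes A: "psd A" and k: "A $ k $ k \<noteq> 0"
  shows "psd (\<chi> i j. A $ i $ j - A $ i $ k * A $ k $ j / A $ k $ k)" (is "psd ?A'")
proof -
  define V :: "complex^'a^'a" where
    "V = (\<chi> i j. (if i = j then 1 else 0) - (if i = k then A $ k $ j / A $ k $ k else 0))"
  have herm: "cnj (A $ i $ j) = A $ j $ i" for i j
    using A by (simp add: psd_def hermitian_matD)
  have AV: "A ** V = ?A'"
    by (simp add: vec_eq_iff matrix_matrix_mult_def V_def right_diff_distrib sum_subtractf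
        if_distrib[of "\<lambda>x. _ * x"] cong: if_cong)
  have "cadjoint V ** ?A' = ?A'"
    using k by (simp add: vec_eq_iff matrix_matrix_mult_def V_def left_diff_distrib sum_subtractf
        if_distrib[of "\<lambda>x. x * _"] if_distrib[of cnj] herm cong: if_cong)
  then have "?A' = cadjoint V ** A ** V"
    by (simp add: AV flip: matrix_mul_assoc)
  then show ?thesis using psd_congruence[OF A, of V] by simp
qed

text \<open>Cholesky elimination, by induction on a set J of indices outside which all rows vanish.
  A nonzero pivot k contributes the column A i k / sqrt (A k k) and leaves the Schur complement; a
  zero pivot forces its row and column to vanish and contributes a zero column.\<close>

lemma psd_sum_rank_one:
  assumes "finite J" "psd A" "\<And>i j. i \<notin> J \<Longrightarrow> A $ i $ j = 0"
  shows "\<exists>B. \<forall>i j. A $ i $ j = (\<Sum>k\<in>J. B i k * cnj (B j k))"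
  using assms
proof (induction J arbitrary: A rule: finite_induct)
  case empty
  then show ?case by simp
next
  case (insert k J)
  have herm: "cnj (A $ i $ j) = A $ j $ i" for i j
    using insert.prems by (simp add: psd_def hermitian_matD)
  have upd: "(\<Sum>l\<in>J. (B(k := b)) l * cnj ((B'(k := b')) l)) = (\<Sum>l\<in>J. B l * cnj (B' l))"
    for B B' :: "'a \<Rightarrow> complex" and b b'
    using insert.hyps by (intro sum.cong) auto
  show ?case
  proof (cases "A $ k $ k = 0")
    case True
    have "A $ i $ j = 0" if "i \<notin> J" for i j
      using insert.prems(2)[of i j] that psd_diagonal_zero[OF insert.prems(1) True] by (cases "i = k") auto
    then obtain B where B: "\<And>i j. A $ i $ j = (\<Sum>k\<in>J. B i k * cnj (B j k))"
      using insert.IH[OF insert.prems(1)] by blast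
    show ?thesis
      by (rule exI[of _ "\<lambda>i. (B i)(k := 0)"])
         (use insert.hyps B upd in \<open>simp del: fun_upd_apply add: fun_upd_same\<close>)
  next
    case False
    define A' where "A' = (\<chi> i j. A $ i $ j - A $ i $ k * A $ k $ j / A $ k $ k)"
    have psd': "psd A'" unfolding A'_def by (rule psd_schur_complement[OF insert.prems(1) False])
    have "A' $ i $ j = 0" if "i \<notin> J" for i j
      using insert.prems(2)[of i] that False by (cases "i = k") (auto simp: A'_def)
    then obtain B where B: "\<And>i j. A' $ i $ j = (\<Sum>k\<in>J. B i k * cnj (B j k))"
      using insert.IH[OF psd'] by blast
    define a where "a = Re (A $ k $ k)"
    have a: "A $ k $ k = of_real a" "a \<ge> 0"
      using psd_diagonal[OF insert.prems(1), of k] by (auto simp: a_def)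
    have sq: "complex_of_real (sqrt a) * complex_of_real (sqrt a) = of_real a"
      using a(2) by (simp flip: of_real_mult)
    have A: "A $ i $ j = A $ i $ k / of_real (sqrt a) * cnj (A $ j $ k / of_real (sqrt a)) + A' $ i $ j" for i j
      by (simp add: A'_def a(1) herm sq)
    show ?thesis
    proof (intro exI[of _ "\<lambda>i. (B i)(k := A $ i $ k / of_real (sqrt a))"] allI)
      fix i j
      show "A $ i $ j = (\<Sum>l\<in>insert k J. ((B i)(k := A $ i $ k / of_real (sqrt a))) l *
          cnj (((B j)(k := A $ j $ k / of_real (sqrt a))) l))"
        unfolding sum.insert[OF insert.hyps] upd fun_upd_same B[symmetric] by (rule A)
    qed
  qed
qed

lemma psd_factorization:
  fixes A :: "complex^'n^'n"
  assumes "psd A"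
  shows "\<exists>B :: complex^'n^'n. A = B ** cadjoint B"
proof -
  have "\<exists>B :: 'n \<Rightarrow> 'n \<Rightarrow> complex. \<forall>i j. A $ i $ j = (\<Sum>k\<in>UNIV. B i k * cnj (B j k))"
    by (rule psd_sum_rank_one) (use assms in auto)
  then obtain B :: "'n \<Rightarrow> 'n \<Rightarrow> complex" where "\<And>i j. A $ i $ j = (\<Sum>k\<in>UNIV. B i k * cnj (B j k))"
    by blast
  then have "A = (\<chi> i k. B i k) ** cadjoint (\<chi> i k. B i k)"
    by (simp add: vec_eq_iff matrix_matrix_mult_def)
  then show ?thesis by blast
qed

lemma pos_def_mat_imp_psd:
  assumes "pos_def_mat A"
  shows "psd A" "invertible A"
proof -
  show "psd A"
    unfolding psd_def
  proof (intro conjI allI)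
    show "0 \<le> Re (hform A v)" for v
      using assms by (cases "v = 0") (auto simp: pos_def_mat_def hform_def less_imp_le)
  qed (use assms in \<open>simp add: pos_def_mat_def\<close>)
  have "v = 0" if "A *v v = 0" for v
  proof (rule ccontr)
    assume "v \<noteq> 0"
    then have "Re (hform A v) > 0" using assms unfolding pos_def_mat_def hform_def by blast
    then show False using that by (simp add: hform_eq_sum)
  qed
  then show "invertible A"
    by (meson invertible_left_inverse matrix_left_invertible_ker)
qed

section \<open>Holomorphic functions on annuli\<close>

definition annulus :: "real \<Rightarrow> real \<Rightarrow> complex set" where
  "annulus a b = {z. a < norm z \<and> norm z < b}"

lemma open_annulus: "open (annulus a b)"
  unfolding annulus_def by (intro open_Collect_conj open_Collect_less continuous_intros)

lemma dist_radial_projection: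
  fixes z :: complex
  assumes "z \<noteq> 0"
  shows "dist (z / of_real (norm z)) z = \<bar>1 - norm z\<bar>"
proof -
  have "z / of_real (norm z) - z = z / of_real (norm z) * (1 - of_real (norm z))"
    using assms by (simp add: field_simps)
  then show ?thesis
    using assms norm_of_real[of "1 - norm z", where 'a = complex]
    by (simp add: dist_norm norm_mult norm_divide)
qed

lemma analytic_on_circle_imp_annulus:
  assumes "f analytic_on sphere 0 1"
  shows "\<exists>e>0. f holomorphic_on annulus (1 - e) (1 + e)"
proof -
  obtain U where U: "open U" "sphere 0 1 \<subseteq> U" "f holomorphic_on U"
    using assms by (auto simp: analytic_on_holomorphic)
  obtain e where e: "e > 0" "(\<Union>x\<in>sphere 0 1. ball x e) \<subseteq> U"
    using compact_subset_open_imp_ball_epsilon_subset[OF compact_sphere U(1,2)] by blast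
  \<comment> \<open>The cap at 1 keeps the inner radius nonnegative, which excludes 0 and makes the
    radial projection available.\<close>
  have "annulus (1 - min e 1) (1 + min e 1) \<subseteq> U"
  proof
    fix z assume z: "z \<in> annulus (1 - min e 1) (1 + min e 1)"
    then have "z \<noteq> 0" by (auto simp: annulus_def)
    have "z \<in> ball (z / of_real (norm z)) e"
      using z dist_radial_projection[OF \<open>z \<noteq> 0\<close>] by (auto simp: annulus_def)
    moreover have "z / of_real (norm z) \<in> sphere 0 1"
      using \<open>z \<noteq> 0\<close> by (simp add: norm_divide)
    ultimately show "z \<in> U" using e(2) by blast
  qed
  then show ?thesis
    using e(1) U(3) by (intro exI[of _ "min e 1"]) (auto intro: holomorphic_on_subset)
qed

text \<open>The linear homotopy between concentric circles passes through circles whose radii are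
  convex combinations of r and s, so it stays in the annulus.\<close>

lemma contour_integral_circlepath_annulus:
  assumes f: "f holomorphic_on annulus a b" and r: "a < r" "r < b" "0 < r" and s: "a < s" "s < b" "0 < s"
  shows "contour_integral (circlepath 0 r) f = contour_integral (circlepath 0 s) f"
proof (rule Cauchy_theorem_homotopic_loops[OF _ open_annulus f])
  show "homotopic_loops (annulus a b) (circlepath 0 r) (circlepath 0 s)"
  proof (rule homotopic_loops_linear)
    fix t :: real
    show "closed_segment (circlepath 0 r t) (circlepath 0 s t) \<subseteq> annulus a b"
    proof
      fix z assume "z \<in> closed_segment (circlepath 0 r t) (circlepath 0 s t)"
      then obtain u where u: "0 \<le> u" "u \<le> 1"
        and z: "z = (1 - u) *\<^sub>R circlepath 0 r t + u *\<^sub>R circlepath 0 s t"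
        by (auto simp: in_segment)
      have "z = of_real ((1 - u) * r + u * s) * exp (2 * of_real pi * \<i> * of_real t)"
        unfolding z circlepath by (simp add: scaleR_conv_of_real algebra_simps)
      then have "norm z = (1 - u) * r + u * s"
        using u r s by (simp add: norm_mult add_nonneg_nonneg del: of_real_add of_real_mult)
      moreover have "a < (1 - u) * r + u * s"
        using u r s convex_bound_lt[of "-r" "-a" "-s" "1 - u" u] by simp
      moreover have "(1 - u) * r + u * s < b"
        using u r s convex_bound_lt[of r b s "1 - u" u] by simp
      ultimately show "z \<in> annulus a b" by (simp add: annulus_def)
    qed
  qed auto
qed auto

text \<open>For |u| = r < 1 = |w| the kernel 1 / (u - w) is a geometric series in u / w, and every
  term integrates to a vanishing moment. Instead of exchanging sum and integral, the proof inserts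
  (u / w)^N: this does not change the integral but bounds it by a multiple of r^N.\<close>

lemma inner_Cauchy_integral_zero:
  assumes f: "continuous_on (sphere 0 r) f" and r: "0 < r" "r < 1"
    and mom: "\<And>n::nat. contour_integral (circlepath 0 r) (\<lambda>u. f u * u ^ n) = 0"
    and w: "norm w = 1"
  shows "contour_integral (circlepath 0 r) (\<lambda>u. f u / (u - w)) = 0"
proof -
  have wn: "w \<noteq> 0" "w \<notin> sphere 0 r" using w r by auto
  have pi: "path_image (circlepath 0 r) = sphere 0 r" using r by simp
  have int: "g contour_integrable_on circlepath 0 r" if "continuous_on (sphere 0 r) g" for g
    using that contour_integrable_continuous_circlepath pi by metis
  have cont: "continuous_on (sphere 0 r) (\<lambda>u. f u / (u - w))"
    using wn by (intro continuous_intros f) auto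
  define I where "I = contour_integral (circlepath 0 r) (\<lambda>u. f u / (u - w))"
  \<comment> \<open>Raising N by one adds f u * u^N / w^(N+1) to the integrand, which is a multiple
    of a moment.\<close>
  have shift: "contour_integral (circlepath 0 r) (\<lambda>u. (u / w) ^ N * (f u / (u - w))) = I" for N
  proof (induction N)
    case 0 then show ?case by (simp add: I_def)
  next
    case (Suc N)
    have "contour_integral (circlepath 0 r) (\<lambda>u. (u / w) ^ Suc N * (f u / (u - w)))
      = contour_integral (circlepath 0 r) (\<lambda>u. (u / w) ^ N * (f u / (u - w)) + f u * u ^ N / w ^ Suc N)"
    proof (rule contour_integral_cong)
      fix u assume "u \<in> path_image (circlepath 0 r)"
      then have "u - w \<noteq> 0" using wn pi by auto
      then show "(u / w) ^ Suc N * (f u / (u - w)) = (u / w) ^ N * (f u / (u - w)) + f u * u ^ N / w ^ Suc N"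
        using wn by (simp add: divide_simps power_divide) (simp add: algebra_simps)
    qed simp
    also have "\<dots> = I"
    proof -
      have "contour_integral (circlepath 0 r) (\<lambda>u. (u / w) ^ N * (f u / (u - w)) + f u * u ^ N / w ^ Suc N)
        = contour_integral (circlepath 0 r) (\<lambda>u. (u / w) ^ N * (f u / (u - w)))
          + contour_integral (circlepath 0 r) (\<lambda>u. f u * u ^ N / w ^ Suc N)"
        using wn by (intro contour_integral_add int continuous_intros cont f) auto
      moreover have "contour_integral (circlepath 0 r) (\<lambda>u. f u * u ^ N / w ^ Suc N)
        = contour_integral (circlepath 0 r) (\<lambda>u. f u * u ^ N) / w ^ Suc N"
        by (intro contour_integral_div int continuous_intros f)
      ultimately show ?thesis by (simp only: Suc mom) simp
    qed
    finally show ?case .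
  qed
  obtain K where K: "K \<ge> 0" "\<And>u. u \<in> sphere 0 r \<Longrightarrow> norm (f u / (u - w)) \<le> K"
  proof -
    have "compact ((\<lambda>u. f u / (u - w)) ` sphere 0 r)"
      by (intro compact_continuous_image cont) auto
    then have "bounded ((\<lambda>u. f u / (u - w)) ` sphere 0 r)" by (rule compact_imp_bounded)
    then show ?thesis using that unfolding bounded_pos by (metis imageI less_imp_le)
  qed
  have bound: "norm I \<le> (r ^ N * K) * (2 * pi * r)" for N
  proof -
    have "norm (contour_integral (circlepath 0 r) (\<lambda>u. (u / w) ^ N * (f u / (u - w)))) \<le> (r ^ N * K) * (2 * pi * r)"
    proof (rule has_contour_integral_bound_circlepath)
      show "((\<lambda>u. (u / w) ^ N * (f u / (u - w))) has_contour_integral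
          contour_integral (circlepath 0 r) (\<lambda>u. (u / w) ^ N * (f u / (u - w)))) (circlepath 0 r)"
        using wn by (intro has_contour_integral_integral int continuous_intros cont) auto
      fix u :: complex assume "norm (u - 0) = r"
      then have "norm ((u / w) ^ N * (f u / (u - w))) = r ^ N * norm (f u / (u - w))"
        using w by (simp add: norm_mult norm_power norm_divide)
      also have "\<dots> \<le> r ^ N * K"
        using K(2)[of u] r \<open>norm (u - 0) = r\<close> by (intro mult_left_mono) auto
      finally show "norm ((u / w) ^ N * (f u / (u - w))) \<le> r ^ N * K" .
    qed (use r K in auto)
    then show ?thesis unfolding shift .
  qed
  have "(\<lambda>N. (r ^ N * K) * (2 * pi * r)) \<longlonglongrightarrow> (0 * K) * (2 * pi * r)"
    using r by (intro tendsto_intros LIMSEQ_realpow_zero) auto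
  then have "norm I \<le> 0"
    by (intro tendsto_lowerbound[of _ 0 sequentially]) (auto intro: bound always_eventually)
  then show ?thesis by (simp add: I_def)
qed

text \<open>The moments are the Laurent coefficients of negative index. In the Cauchy formula for an
  annulus they make up the integral over the inner circle, so f agrees on the unit circle with the
  integral over the outer one, and that integral is holomorphic in the whole larger disc.\<close>

lemma holomorphic_extension_to_disc:
  assumes f: "f holomorphic_on annulus a b" and ab: "a < 1" "1 < b"
    and mom: "\<And>n::nat. contour_integral (circlepath 0 1) (\<lambda>u. f u * u ^ n) = 0"
  shows "\<exists>h. h analytic_on cball 0 1 \<and> (\<forall>w\<in>sphere 0 1. h w = f w) \<and>
             h 0 = contour_integral (circlepath 0 1) (\<lambda>u. f u / u) / (2 * of_real pi * \<i>)"
proof -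
  \<comment> \<open>The lower bound a may be negative, while the radius r must be positive.\<close>
  define r where "r = (max a 0 + 1) / 2"
  define R where "R = (1 + b) / 2"
  have r: "a < r" "0 < r" "r < 1" "r < b" using ab by (auto simp: r_def max_def)
  have R: "1 < R" "R < b" "a < R" "0 < R" using ab by (auto simp: R_def)
  have cont: "continuous_on (annulus a b) f" by (rule holomorphic_on_imp_continuous_on[OF f])
  have sph: "sphere 0 s \<subseteq> annulus a b" if "a < s" "s < b" for s using that by (auto simp: annulus_def)
  have contR: "continuous_on (path_image (circlepath 0 R)) f"
    using R by (intro continuous_on_subset[OF cont]) (auto simp: annulus_def)
  define h where "h w = contour_integral (circlepath 0 R) (\<lambda>u. f u / (u - w)) / (2 * of_real pi * \<i>)" for w
  have int: "(\<lambda>u. f u / (u - w)) contour_integrable_on circlepath 0 R" if "w \<in> ball 0 R" for w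
    using that R by (intro contour_integrable_continuous_circlepath continuous_intros contR) auto
  have hol: "h holomorphic_on ball 0 R"
  proof -
    have "((\<lambda>w. contour_integral (circlepath 0 R) (\<lambda>u. f u / (u - w))) has_field_derivative
        of_nat 1 * contour_integral (circlepath 0 R) (\<lambda>u. f u / (u - w) ^ Suc 1)) (at w)"
      if "w \<in> ball 0 R" for w
      using Cauchy_next_derivative_circlepath(2)[OF contR, of 1
          "\<lambda>w. contour_integral (circlepath 0 R) (\<lambda>u. f u / (u - w))" w]
        that has_contour_integral_integral[OF int] by simp
    then have "(\<lambda>w. contour_integral (circlepath 0 R) (\<lambda>u. f u / (u - w))) holomorphic_on ball 0 R"
      unfolding holomorphic_on_open[OF open_ball] by blast
    then show ?thesis unfolding h_def by (intro holomorphic_intros) auto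
  qed
  have "h analytic_on cball 0 1"
    using hol R by (auto simp: analytic_on_holomorphic intro!: exI[of _ "ball 0 R"])
  moreover have "h w = f w" if "w \<in> sphere 0 1" for w
  proof -
    have w: "norm w = 1" using that by simp
    \<comment> \<open>The difference quotient has a removable singularity at w. Equality of its
      integrals over the outer and inner circles is the Cauchy formula for the annulus.\<close>
    define g where "g u = (if u = w then deriv f w else (f u - f w) / (u - w))" for u
    have "g holomorphic_on annulus a b"
      unfolding g_def by (rule pole_lemma_open[OF f open_annulus])
    then have "contour_integral (circlepath 0 R) g = contour_integral (circlepath 0 r) g"
      using r R by (intro contour_integral_circlepath_annulus[of _ a b]) auto
    moreover have "contour_integral (circlepath 0 s) g =
        contour_integral (circlepath 0 s) (\<lambda>u. f u / (u - w)) - f w * contour_integral (circlepath 0 s) (\<lambda>u. 1 / (u - w))"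
      if s: "a < s" "s < b" "0 < s" "s \<noteq> 1" for s
    proof -
      have ne: "u - w \<noteq> 0" if "u \<in> sphere 0 s" for u using that w s by auto
      have ints: "k contour_integrable_on circlepath 0 s" if "continuous_on (sphere 0 s) k" for k
        by (rule contour_integrable_continuous_circlepath) (use s that in simp)
      have conts: "continuous_on (sphere 0 s) f" by (rule continuous_on_subset[OF cont sph]) fact+
      have "contour_integral (circlepath 0 s) g =
          contour_integral (circlepath 0 s) (\<lambda>u. f u / (u - w) - f w * (1 / (u - w)))"
        using ne s by (intro contour_integral_cong) (auto simp: g_def diff_divide_distrib)
      also have "\<dots> = contour_integral (circlepath 0 s) (\<lambda>u. f u / (u - w)) - f w * contour_integral (circlepath 0 s) (\<lambda>u. 1 / (u - w))"
      proof -
        have 1: "(\<lambda>u. 1 / (u - w)) contour_integrable_on circlepath 0 s"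
          using ne by (intro ints continuous_intros) auto
        have 2: "(\<lambda>u. f u / (u - w)) contour_integrable_on circlepath 0 s"
          using ne by (intro ints continuous_intros conts) auto
        show ?thesis
          by (subst contour_integral_diff[OF 2 contour_integrable_lmul[OF 1]])
             (simp only: contour_integral_lmul[OF 1])
      qed
      finally show ?thesis .
    qed
    moreover have "contour_integral (circlepath 0 R) (\<lambda>u. 1 / (u - w)) = 2 * of_real pi * \<i> * 1"
      using Cauchy_integral_circlepath_simple[of "\<lambda>_. 1" 0 R w] w R by (intro contour_integral_unique) auto
    moreover have "contour_integral (circlepath 0 r) (\<lambda>u. 1 / (u - w)) = 0"
    proof (rule contour_integral_unique, rule Cauchy_theorem_disc_simple[of _ 0 1])
      show "(\<lambda>u. 1 / (u - w)) holomorphic_on ball 0 1"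
        using w by (intro holomorphic_intros) auto
    qed (use r in auto)
    moreover have "contour_integral (circlepath 0 r) (\<lambda>u. f u / (u - w)) = 0"
    proof (rule inner_Cauchy_integral_zero)
      show "continuous_on (sphere 0 r) f" using r by (intro continuous_on_subset[OF cont sph]) auto
      fix n :: nat
      show "contour_integral (circlepath 0 r) (\<lambda>u. f u * u ^ n) = 0"
        using contour_integral_circlepath_annulus[of "\<lambda>u. f u * u ^ n" a b r 1] mom[of n] r ab
        by (simp add: holomorphic_on_mult[OF f] holomorphic_on_power holomorphic_on_ident)
    qed (use r w in auto)
    ultimately show ?thesis using r R by (simp add: h_def)
  qed
  moreover have "h 0 = contour_integral (circlepath 0 1) (\<lambda>u. f u / u) / (2 * of_real pi * \<i>)"
  proof -
    have "(\<lambda>u. f u / u) holomorphic_on annulus (max a 0) b"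
      using f by (intro holomorphic_intros) (auto simp: annulus_def elim!: holomorphic_on_subset)
    then have "contour_integral (circlepath 0 R) (\<lambda>u. f u / u) = contour_integral (circlepath 0 1) (\<lambda>u. f u / u)"
      using R ab by (intro contour_integral_circlepath_annulus[of _ "max a 0" b]) auto
    then show ?thesis by (simp add: h_def)
  qed
  ultimately show ?thesis by blast
qed

section \<open>Fourier coefficients and Toeplitz operators\<close>

text \<open>The characters of the circle with period 1, the parametrisation of
  \<open>circlepath\<close>.\<close>

definition efun :: "int \<Rightarrow> real \<Rightarrow> complex" where
  "efun n t = exp (2 * of_real pi * \<i> * of_int n * of_real t)"

lemma efun_add: "efun (m + n) t = efun m t * efun n t"
  by (simp add: efun_def algebra_simps flip: exp_add)

lemma efun_0 [simp]: "efun 0 t = 1"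
  by (simp add: efun_def)

lemma norm_efun [simp]: "norm (efun n t) = 1"
  by (simp add: efun_def)

lemma cnj_efun [simp]: "cnj (efun n t) = efun (- n) t"
  by (simp add: efun_def exp_cnj)

lemma continuous_on_efun [continuous_intros]: "continuous_on S (efun n)"
  unfolding efun_def by (intro continuous_intros)

lemma integral_efun: "(efun n has_integral (if n = 0 then 1 else 0)) {0..1}"
proof (cases "n = 0")
  case True
  then show ?thesis using has_integral_const_real[of "1::complex" 0 1] by (simp add: efun_def[abs_def])
next
  case False
  define c where "c = 2 * of_real pi * \<i> * of_int n"
  have c: "c \<noteq> 0" using False by (simp add: c_def)
  have "((\<lambda>t. exp (c * of_real t)) has_integral exp (c * of_real 1) / c - exp (c * of_real 0) / c) {0..1}"
  proof (rule fundamental_theorem_of_calculus)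
    fix t :: real
    have "((\<lambda>z. exp (c * z) / c) has_field_derivative exp (c * of_real t)) (at (of_real t))"
      using c by (auto intro!: derivative_eq_intros)
    from has_vector_derivative_real_field[OF this]
    show "((\<lambda>t. exp (c * of_real t) / c) has_vector_derivative exp (c * of_real t)) (at t within {0..1})"
      by simp
  qed simp
  moreover have "exp c = 1"
    using exp_integer_2pi[of "of_int n"] by (simp add: c_def mult_ac)
  ultimately show ?thesis using False by (simp add: efun_def[abs_def] c_def)
qed

lemma integral_trig_poly_norm:
  "((\<lambda>t. (norm (\<Sum>k<K. a k * efun (int k) t))\<^sup>2) has_integral (\<Sum>k<K. (norm (a k))\<^sup>2)) {0..1}"
proof -
  have "((\<lambda>t. \<Sum>k<K. \<Sum>l<K. a k * cnj (a l) * efun (int k - int l) t) has_integral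
      (\<Sum>k<K. \<Sum>l<K. a k * cnj (a l) * (if int k - int l = 0 then 1 else 0))) {0..1}"
    by (intro has_integral_sum has_integral_mult_right integral_efun) auto
  moreover have "(\<Sum>k<K. \<Sum>l<K. a k * cnj (a l) * efun (int k - int l) t)
      = of_real ((norm (\<Sum>k<K. a k * efun (int k) t))\<^sup>2)" for t
    unfolding complex_norm_square
    by (simp add: sum_product efun_add[of _ "- _", simplified] mult_ac)
  moreover have "(\<Sum>k<K. \<Sum>l<K. a k * cnj (a l) * (if int k - int l = 0 then 1 else 0))
      = of_real (\<Sum>k<K. (norm (a k))\<^sup>2)"
    by (simp add: if_distrib[of "\<lambda>x. _ * x"] complex_norm_square cong: if_cong del: of_real_power)
  ultimately have "((\<lambda>t. complex_of_real ((norm (\<Sum>k<K. a k * efun (int k) t))\<^sup>2)) has_integral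
      of_real (\<Sum>k<K. (norm (a k))\<^sup>2)) {0..1}"
    by simp
  from has_integral_Re[OF this] show ?thesis by simp
qed

text \<open>The integral of |f - p|^2 is nonnegative for the partial Fourier sum p. Only frequencies
  n \<ge> 0 appear, the ones that a Toeplitz operator retains.\<close>

lemma Bessel_inequality:
  assumes f: "continuous_on {0..1} f"
  shows "(\<Sum>n<N. (norm (integral {0..1} (\<lambda>t. f t * efun (- int n) t)))\<^sup>2) \<le> integral {0..1} (\<lambda>t. (norm (f t))\<^sup>2)"
proof -
  define c where "c n = integral {0..1} (\<lambda>t. f t * efun (- int n) t)" for n :: nat
  define p where "p t = (\<Sum>n<N. c n * efun (int n) t)" for t
  have c: "((\<lambda>t. f t * efun (- int n) t) has_integral c n) {0..1}" for n
    unfolding c_def by (intro integrable_integral integrable_continuous_interval continuous_intros f)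
  have "((\<lambda>t. \<Sum>n<N. cnj (c n) * (f t * efun (- int n) t)) has_integral (\<Sum>n<N. cnj (c n) * c n)) {0..1}"
    by (intro has_integral_sum has_integral_mult_right c) auto
  moreover have "(\<Sum>n<N. cnj (c n) * (f t * efun (- int n) t)) = f t * cnj (p t)" for t
    by (simp add: p_def sum_distrib_left mult_ac)
  moreover have "(\<Sum>n<N. cnj (c n) * c n) = of_real (\<Sum>n<N. (norm (c n))\<^sup>2)"
    by (simp add: complex_norm_square mult.commute del: of_real_power)
  ultimately have "((\<lambda>t. f t * cnj (p t)) has_integral of_real (\<Sum>n<N. (norm (c n))\<^sup>2)) {0..1}"
    by simp
  from has_integral_Re[OF this]
  have fp: "((\<lambda>t. Re (f t * cnj (p t))) has_integral (\<Sum>n<N. (norm (c n))\<^sup>2)) {0..1}" by simp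
  have pp: "((\<lambda>t. (norm (p t))\<^sup>2) has_integral (\<Sum>n<N. (norm (c n))\<^sup>2)) {0..1}"
    unfolding p_def by (rule integral_trig_poly_norm)
  have ff: "((\<lambda>t. (norm (f t))\<^sup>2) has_integral integral {0..1} (\<lambda>t. (norm (f t))\<^sup>2)) {0..1}"
    by (intro integrable_integral integrable_continuous_interval continuous_intros f)
  have "((\<lambda>t. (norm (f t))\<^sup>2 - 2 * Re (f t * cnj (p t)) + (norm (p t))\<^sup>2) has_integral
     integral {0..1} (\<lambda>t. (norm (f t))\<^sup>2) - 2 * (\<Sum>n<N. (norm (c n))\<^sup>2) + (\<Sum>n<N. (norm (c n))\<^sup>2)) {0..1}"
    by (intro has_integral_add has_integral_diff has_integral_mult_right ff fp pp)
  moreover have "(norm (f t))\<^sup>2 - 2 * Re (f t * cnj (p t)) + (norm (p t))\<^sup>2 = (norm (f t - p t))\<^sup>2" for t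
    unfolding cmod_power2 by (simp add: power2_eq_square algebra_simps)
  ultimately have "((\<lambda>t. (norm (f t - p t))\<^sup>2) has_integral
     integral {0..1} (\<lambda>t. (norm (f t))\<^sup>2) - 2 * (\<Sum>n<N. (norm (c n))\<^sup>2) + (\<Sum>n<N. (norm (c n))\<^sup>2)) {0..1}"
    by (simp only:)
  then have "0 \<le> integral {0..1} (\<lambda>t. (norm (f t))\<^sup>2) - 2 * (\<Sum>n<N. (norm (c n))\<^sup>2) + (\<Sum>n<N. (norm (c n))\<^sup>2)"
    by (rule has_integral_nonneg) simp
  then show ?thesis by (simp add: c_def)
qed

section \<open>The Frobenius norm of matrices\<close>

lemma norm_matrix_sq: "(norm A)\<^sup>2 = (\<Sum>i\<in>UNIV. \<Sum>j\<in>UNIV. (norm (A $ i $ j))\<^sup>2)"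
  for A :: "complex^'n^'m"
  by (simp add: norm_vec_def L2_set_def sum_nonneg)

text \<open>Cauchy-Schwarz applied to each entry of the product, then summed.\<close>

lemma norm_matrix_mult_le: "norm (A ** B) \<le> norm A * norm B" for A :: "complex^'n^'m" and B :: "complex^'k^'n"
proof -
  have "(norm ((A ** B) $ i $ j))\<^sup>2 \<le> (\<Sum>l\<in>UNIV. (norm (A $ i $ l))\<^sup>2) * (\<Sum>l\<in>UNIV. (norm (B $ l $ j))\<^sup>2)" for i j
  proof -
    have "norm ((A ** B) $ i $ j) \<le> (\<Sum>l\<in>UNIV. norm (A $ i $ l) * norm (B $ l $ j))"
      unfolding matrix_matrix_mult_def by (simp add: norm_mult[symmetric] norm_sum)
    then have "(norm ((A ** B) $ i $ j))\<^sup>2 \<le> (\<Sum>l\<in>UNIV. norm (A $ i $ l) * norm (B $ l $ j))\<^sup>2"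
      by (intro power_mono) auto
    also have "\<dots> \<le> (\<Sum>l\<in>UNIV. (norm (A $ i $ l))\<^sup>2) * (\<Sum>l\<in>UNIV. (norm (B $ l $ j))\<^sup>2)"
      by (rule Cauchy_Schwarz_ineq_sum)
    finally show ?thesis .
  qed
  then have "(norm (A ** B))\<^sup>2 \<le> (\<Sum>i\<in>UNIV. \<Sum>j\<in>UNIV. (\<Sum>l\<in>UNIV. (norm (A $ i $ l))\<^sup>2) * (\<Sum>l\<in>UNIV. (norm (B $ l $ j))\<^sup>2))"
    unfolding norm_matrix_sq by (intro sum_mono) auto
  also have "\<dots> = (\<Sum>i\<in>UNIV. \<Sum>l\<in>UNIV. (norm (A $ i $ l))\<^sup>2) * (\<Sum>j\<in>UNIV. \<Sum>l\<in>UNIV. (norm (B $ l $ j))\<^sup>2)"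
    by (simp add: sum_product)
  also have "(\<Sum>j\<in>UNIV. \<Sum>l\<in>UNIV. (norm (B $ l $ j))\<^sup>2) = (norm B)\<^sup>2"
    unfolding norm_matrix_sq by (rule sum.swap)
  finally have "(norm (A ** B))\<^sup>2 \<le> (norm A * norm B)\<^sup>2"
    by (simp add: norm_matrix_sq power_mult_distrib)
  then show ?thesis by (rule power2_le_imp_le) simp
qed

lemma bounded_bilinear_matrix_mult:
  "bounded_bilinear ((**) :: complex^'n^'m \<Rightarrow> complex^'k^'n \<Rightarrow> complex^'k^'m)"
proof
  show "\<exists>K. \<forall>A B. norm ((A::complex^'n^'m) ** (B::complex^'k^'n)) \<le> norm A * norm B * K"
    by (rule exI[of _ 1]) (simp add: norm_matrix_mult_le)
qed (simp_all add: vec_eq_iff matrix_matrix_mult_def algebra_simps sum.distrib scaleR_sum_right)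

section \<open>Toeplitz operators with a matrix symbol\<close>

definition fcoeff :: "(real \<Rightarrow> complex^'n^'n) \<Rightarrow> int \<Rightarrow> complex^'n^'n" where
  "fcoeff g n = (\<chi> i j. integral {0..1} (\<lambda>t. g t $ i $ j * efun (- n) t))"

text \<open>Multiplying a trigonometric polynomial by g convolves the coefficients, so the n-th
  coefficient is an entry of the Toeplitz operator applied to a. The unknowns stand on the left of
  the symbol because the product X F is what is being solved for.\<close>

lemma fcoeff_poly_mult:
  assumes g: "continuous_on {0..1} g"
  shows "integral {0..1} (\<lambda>t. ((\<chi> i j. \<Sum>k<K. a k $ i $ j * efun (int k) t) ** g t) $ i $ j * efun (- int n) t)
    = (\<Sum>k<K. a k ** fcoeff g (int n - int k)) $ i $ j"
proof (rule integral_unique)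
  have "((\<lambda>t. \<Sum>k<K. \<Sum>l\<in>UNIV. a k $ i $ l * (g t $ l $ j * efun (- (int n - int k)) t)) has_integral
      (\<Sum>k<K. \<Sum>l\<in>UNIV. a k $ i $ l * fcoeff g (int n - int k) $ l $ j)) {0..1}"
    unfolding fcoeff_def vec_lambda_beta
    by (intro has_integral_sum has_integral_mult_right integrable_integral integrable_continuous_interval
        continuous_intros g) auto
  moreover have "(\<Sum>k<K. \<Sum>l\<in>UNIV. a k $ i $ l * (g t $ l $ j * efun (- (int n - int k)) t))
      = ((\<chi> i j. \<Sum>k<K. a k $ i $ j * efun (int k) t) ** g t) $ i $ j * efun (- int n) t" for t
  proof -
    have "efun (- (int n - int k)) t = efun (int k) t * efun (- int n) t" for k
      by (simp flip: efun_add)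
    then have "(\<Sum>k<K. \<Sum>l\<in>UNIV. a k $ i $ l * (g t $ l $ j * efun (- (int n - int k)) t))
      = (\<Sum>l\<in>UNIV. \<Sum>k<K. a k $ i $ l * efun (int k) t * g t $ l $ j * efun (- int n) t)"
      by (subst sum.swap) (simp add: mult_ac)
    then show ?thesis
      by (simp add: matrix_matrix_mult_def sum_distrib_right)
  qed
  ultimately show "((\<lambda>t. ((\<chi> i j. \<Sum>k<K. a k $ i $ j * efun (int k) t) ** g t) $ i $ j * efun (- int n) t)
     has_integral (\<Sum>k<K. a k ** fcoeff g (int n - int k)) $ i $ j) {0..1}"
    by (simp add: matrix_matrix_mult_def)
qed

text \<open>The Toeplitz operator is multiplication by g followed by a projection to nonnegative
  frequencies. The first is bounded pointwise by q, the second is Bessel, and the norm of the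
  polynomial is computed exactly by orthonormality.\<close>

lemma Toeplitz_contraction_finite:
  fixes g :: "real \<Rightarrow> complex^'n^'n" and a :: "nat \<Rightarrow> complex^'n^'n"
  assumes g: "continuous_on {0..1} g"
    and q: "\<And>t (A::complex^'n^'n). t \<in> {0..1} \<Longrightarrow> (norm (A ** g t))\<^sup>2 \<le> q * (norm A)\<^sup>2"
  shows "(\<Sum>n<N. (norm (\<Sum>k<K. a k ** fcoeff g (int n - int k)))\<^sup>2) \<le> q * (\<Sum>k<K. (norm (a k))\<^sup>2)"
proof -
  define p where "p t = (\<chi> i j. \<Sum>k<K. a k $ i $ j * efun (int k) t)" for t
  have p: "continuous_on {0..1} (\<lambda>t. p t $ i $ j)" for i j
    unfolding p_def by (auto intro!: continuous_intros)
  have pg: "continuous_on {0..1} (\<lambda>t. (p t ** g t) $ i $ j)" for i j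
    unfolding matrix_matrix_mult_def by (auto intro!: continuous_intros p g)
  have "(\<Sum>n<N. (norm (\<Sum>k<K. a k ** fcoeff g (int n - int k)))\<^sup>2)
     = (\<Sum>i\<in>UNIV. \<Sum>j\<in>UNIV. \<Sum>n<N. (norm (integral {0..1} (\<lambda>t. (p t ** g t) $ i $ j * efun (- int n) t)))\<^sup>2)"
    unfolding norm_matrix_sq p_def fcoeff_poly_mult[OF g]
    by (subst sum.swap, rule sum.cong[OF refl], subst sum.swap) simp
  also have "\<dots> \<le> (\<Sum>i\<in>UNIV. \<Sum>j\<in>UNIV. integral {0..1} (\<lambda>t. (norm ((p t ** g t) $ i $ j))\<^sup>2))"
    by (intro sum_mono Bessel_inequality pg)
  also have "\<dots> = integral {0..1} (\<lambda>t. \<Sum>i\<in>UNIV. \<Sum>j\<in>UNIV. (norm ((p t ** g t) $ i $ j))\<^sup>2)"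
    by (intro integral_unique[symmetric] has_integral_sum integrable_integral integrable_continuous_interval
          continuous_intros pg) auto
  also have "\<dots> \<le> integral {0..1} (\<lambda>t. q * (\<Sum>i\<in>UNIV. \<Sum>j\<in>UNIV. (norm (p t $ i $ j))\<^sup>2))"
    by (intro integral_le integrable_continuous_interval continuous_on_mult_left continuous_on_sum
          continuous_on_power continuous_on_norm pg p)
       (rule q[unfolded norm_matrix_sq])
  also have "\<dots> = q * (\<Sum>i\<in>UNIV. \<Sum>j\<in>UNIV. \<Sum>k<K. (norm (a k $ i $ j))\<^sup>2)"
    unfolding p_def vec_lambda_beta
    by (intro integral_unique has_integral_sum has_integral_mult_right integral_trig_poly_norm) auto
  also have "(\<Sum>i\<in>UNIV. \<Sum>j\<in>UNIV. \<Sum>k<K. (norm (a k $ i $ j))\<^sup>2) = (\<Sum>k<K. (norm (a k))\<^sup>2)"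
    unfolding norm_matrix_sq
    by (subst (2) sum.swap, rule sum.cong[OF refl], subst (2) sum.swap) simp
  finally show ?thesis .
qed

text \<open>Passage from finite to infinite sequences: square summability is expressed by the bound
  b on all partial sums, and summability of the symbol coefficients makes each entry converge. With
  N fixed, the estimate is a limit of the finite ones.\<close>

lemma Toeplitz_contraction:
  fixes G :: "int \<Rightarrow> complex^'n^'n" and a :: "nat \<Rightarrow> complex^'n^'n"
  assumes sm: "\<And>n::nat. summable (\<lambda>k. norm (G (int n - int k)))"
    and contr: "\<And>N K a. (\<Sum>n<N. (norm (\<Sum>k<K. a k ** G (int n - int k)))\<^sup>2) \<le> q * (\<Sum>k<K. (norm (a k :: complex^'n^'n))\<^sup>2)"
    and q: "0 \<le> q"
    and a: "\<And>K. (\<Sum>k<K. (norm (a k))\<^sup>2) \<le> b"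
  shows "summable (\<lambda>k. norm (a k ** G (int n - int k)))"
    and "(\<Sum>n<N. (norm (\<Sum>k. a k ** G (int n - int k)))\<^sup>2) \<le> q * b"
proof -
  have bd: "norm (a k) \<le> sqrt b" for k
  proof (rule real_le_rsqrt)
    have "(norm (a k))\<^sup>2 \<le> (\<Sum>k<Suc k. (norm (a k))\<^sup>2)"
      by (rule member_le_sum) auto
    also have "\<dots> \<le> b" by (rule a)
    finally show "(norm (a k))\<^sup>2 \<le> b" .
  qed
  show sum: "summable (\<lambda>k. norm (a k ** G (int n - int k)))" for n
  proof (rule summable_comparison_test)
    show "summable (\<lambda>k. sqrt b * norm (G (int n - int k)))"
      by (intro summable_mult sm)
    show "\<exists>N. \<forall>k\<ge>N. norm (norm (a k ** G (int n - int k))) \<le> sqrt b * norm (G (int n - int k))"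
      using bd by (auto intro!: order.trans[OF norm_matrix_mult_le] mult_right_mono)
  qed
  have lim: "(\<lambda>K. \<Sum>k<K. a k ** G (int n - int k)) \<longlonglongrightarrow> (\<Sum>k. a k ** G (int n - int k))" for n
    by (intro summable_LIMSEQ summable_norm_cancel[OF sum])
  have "(\<lambda>K. \<Sum>n<N. (norm (\<Sum>k<K. a k ** G (int n - int k)))\<^sup>2) \<longlonglongrightarrow> (\<Sum>n<N. (norm (\<Sum>k. a k ** G (int n - int k)))\<^sup>2)"
    by (intro tendsto_intros lim)
  then show "(\<Sum>n<N. (norm (\<Sum>k. a k ** G (int n - int k)))\<^sup>2) \<le> q * b"
  proof (rule LIMSEQ_le_const2, intro exI allI impI)
    fix K
    have "(\<Sum>n<N. (norm (\<Sum>k<K. a k ** G (int n - int k)))\<^sup>2) \<le> q * (\<Sum>k<K. (norm (a k))\<^sup>2)" by (rule contr)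
    also have "\<dots> \<le> q * b" by (intro mult_left_mono a q)
    finally show "(\<Sum>n<N. (norm (\<Sum>k<K. a k ** G (int n - int k)))\<^sup>2) \<le> q * b" .
  qed
qed

text \<open>X is the sum of T^m e over m, where T is the Toeplitz operator and e has the identity
  matrix at index 0, so that T X = X - e. The l2 bound controls each entry by a multiple of q^m,
  which is enough to exchange the sum over m with the sum defining T.\<close>

lemma Toeplitz_Neumann_series:
  fixes G :: "int \<Rightarrow> complex^'n^'n"
  assumes sm: "\<And>n::nat. summable (\<lambda>k. norm (G (int n - int k)))"
    and contr: "\<And>N K a. (\<Sum>n<N. (norm (\<Sum>k<K. a k ** G (int n - int k)))\<^sup>2) \<le> q\<^sup>2 * (\<Sum>k<K. (norm (a k :: complex^'n^'n))\<^sup>2)"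
    and q: "0 \<le> q" "q < 1"
  shows "\<exists>X B. (\<forall>n. norm (X n) \<le> B) \<and>
    (\<forall>n. (\<lambda>k. X k ** G (int n - int k)) sums (X n - (if n = 0 then mat 1 else 0)))"
proof -
  define T where "T a n = (\<Sum>k. a k ** G (int n - int k))" for a :: "nat \<Rightarrow> complex^'n^'n" and n :: nat
  define E where "E m = (T ^^ m) (\<lambda>n. if n = 0 then mat 1 else 0)" for m
  define \<beta> where "\<beta> = norm (mat 1 :: complex^'n^'n)"
  have E0: "E 0 n = (if n = 0 then mat 1 else 0)" for n by (simp add: E_def)
  have ESuc: "E (Suc m) n = (\<Sum>k. E m k ** G (int n - int k))" for m n by (simp add: E_def T_def)
  have l2: "(\<Sum>n<N. (norm (E m n))\<^sup>2) \<le> (q\<^sup>2) ^ m * \<beta>\<^sup>2" for m N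
  proof (induction m arbitrary: N)
    case 0
    have "(\<Sum>n<N. (norm (E 0 n))\<^sup>2) = (\<Sum>n<N. if n = 0 then \<beta>\<^sup>2 else 0)"
      by (rule sum.cong) (auto simp: E0 \<beta>_def)
    then show ?case by (simp add: \<beta>_def)
  next
    case (Suc m)
    show ?case
      using Toeplitz_contraction(2)[OF sm contr _ Suc.IH] by (simp add: ESuc mult.assoc)
  qed
  have sumE: "summable (\<lambda>k. E m k ** G (int n - int k))" for m n
    by (rule summable_norm_cancel[OF Toeplitz_contraction(1)[OF sm contr _ l2]]) simp
  have bd: "norm (E m n) \<le> \<beta> * q ^ m" for m n
  proof (rule power2_le_imp_le)
    have "(norm (E m n))\<^sup>2 \<le> (\<Sum>n<Suc n. (norm (E m n))\<^sup>2)"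
      by (rule member_le_sum) auto
    also have "\<dots> \<le> (q\<^sup>2) ^ m * \<beta>\<^sup>2" by (rule l2)
    finally show "(norm (E m n))\<^sup>2 \<le> (\<beta> * q ^ m)\<^sup>2"
      by (simp add: power_mult_distrib mult.commute flip: power_mult)
  qed (use q in \<open>simp add: \<beta>_def\<close>)
  have geo: "summable (\<lambda>m. \<beta> * q ^ m)" using q by (intro summable_mult summable_geometric) auto
  have smE: "summable (\<lambda>m. E m n)" for n
    by (rule summable_comparison_test[OF _ geo]) (use bd in auto)
  define X where "X n = (\<Sum>m. E m n)" for n
  define S where "S M n = (\<Sum>m<M. E m n)" for M n
  define B where "B = (\<Sum>m. \<beta> * q ^ m)"
  have SX: "(\<lambda>M. S M n) \<longlonglongrightarrow> X n" for n
    unfolding S_def X_def by (rule summable_LIMSEQ[OF smE])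
  have SB: "norm (S M n) \<le> B" for M n
  proof -
    have "norm (S M n) \<le> (\<Sum>m<M. \<beta> * q ^ m)" unfolding S_def by (intro sum_norm_le bd)
    also have "\<dots> \<le> B" unfolding B_def using q by (intro sum_le_suminf geo) (auto simp: \<beta>_def)
    finally show ?thesis .
  qed
  have XB: "norm (X n) \<le> B" for n
    by (rule LIMSEQ_le_const2[OF tendsto_norm[OF SX]]) (use SB in auto)
  \<comment> \<open>The bound is uniform in n, so the tail can be estimated under T by the summable
    coefficient norms alone.\<close>
  have tail: "norm (S M n - X n) \<le> \<beta> / (1 - q) * q ^ M" for M n
  proof -
    have "norm (S M n - X n) = norm (\<Sum>m. E (m + M) n)"
      unfolding X_def S_def suminf_minus_initial_segment[OF smE] by (rule norm_minus_commute)
    also have "\<dots> \<le> (\<Sum>m. \<beta> * q ^ M * q ^ m)"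
    proof (rule norm_suminf_le)
      show "norm (E (m + M) n) \<le> \<beta> * q ^ M * q ^ m" for m
        using bd[of "m + M" n] by (simp add: power_add mult_ac)
      show "summable (\<lambda>m. \<beta> * q ^ M * q ^ m)" using q by (intro summable_mult summable_geometric) auto
    qed
    also have "\<dots> = \<beta> * q ^ M * (1 / (1 - q))"
      using q by (subst suminf_mult) (auto intro!: summable_geometric simp: suminf_geometric)
    finally show ?thesis by simp
  qed
  have "(\<lambda>k. X k ** G (int n - int k)) sums (X n - (if n = 0 then mat 1 else 0))" for n
  proof -
    have smB: "summable (\<lambda>k. B * norm (G (int n - int k)))" by (intro summable_mult sm)
    have le: "norm (Y k ** G (int n - int k)) \<le> B * norm (G (int n - int k))" if "\<And>k. norm (Y k) \<le> B" for Y :: "nat \<Rightarrow> complex^'n^'n" and k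
      using that by (intro order.trans[OF norm_matrix_mult_le] mult_right_mono) auto
    have summ: "summable (\<lambda>k. X k ** G (int n - int k))"
      by (rule summable_comparison_test[OF _ smB]) (use le[of X, OF XB] in auto)
    have "(\<lambda>M. \<Sum>k. S M k ** G (int n - int k)) \<longlonglongrightarrow> (\<Sum>k. X k ** G (int n - int k))"
    proof (rule LIM_zero_cancel, rule tendsto_norm_zero_cancel, rule tendsto_sandwich[of "\<lambda>_. 0"])
      define g where "g = (\<Sum>k. norm (G (int n - int k)))"
      have "norm ((\<Sum>k. S M k ** G (int n - int k)) - (\<Sum>k. X k ** G (int n - int k))) \<le> \<beta> / (1 - q) * q ^ M * g" for M
      proof -
        have summS: "summable (\<lambda>k. S M k ** G (int n - int k))"
          by (rule summable_comparison_test[OF _ smB]) (use le[of "S M", OF SB] in auto)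
        have "(\<Sum>k. S M k ** G (int n - int k)) - (\<Sum>k. X k ** G (int n - int k))
          = (\<Sum>k. (S M k - X k) ** G (int n - int k))"
          by (simp add: suminf_diff[OF summS summ] bounded_bilinear.diff_left[OF bounded_bilinear_matrix_mult])
        also have "norm \<dots> \<le> (\<Sum>k. \<beta> / (1 - q) * q ^ M * norm (G (int n - int k)))"
        proof (rule norm_suminf_le)
          show "norm ((S M k - X k) ** G (int n - int k)) \<le> \<beta> / (1 - q) * q ^ M * norm (G (int n - int k))" for k
            by (intro order.trans[OF norm_matrix_mult_le] mult_right_mono tail) simp
        qed (intro summable_mult sm)
        also have "\<dots> = \<beta> / (1 - q) * q ^ M * g"
          unfolding g_def by (rule suminf_mult[OF sm])
        finally show ?thesis .
      qed
      then show "\<forall>\<^sub>F M in sequentially. norm ((\<Sum>k. S M k ** G (int n - int k)) - (\<Sum>k. X k ** G (int n - int k))) \<le> \<beta> / (1 - q) * q ^ M * g"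
        by (intro always_eventually allI)
      have "(\<lambda>M. \<beta> / (1 - q) * q ^ M * g) \<longlonglongrightarrow> \<beta> / (1 - q) * 0 * g"
        using q by (intro tendsto_intros LIMSEQ_realpow_zero) auto
      then show "(\<lambda>M. \<beta> / (1 - q) * q ^ M * g) \<longlonglongrightarrow> 0" by simp
    qed auto
    moreover have "(\<lambda>M. \<Sum>k. S M k ** G (int n - int k)) \<longlonglongrightarrow> X n - E 0 n"
    proof -
      \<comment> \<open>T maps the M-th partial sum to the next one without its initial term; in the
        limit this is the claimed equation.\<close>
      have "(\<Sum>k. S M k ** G (int n - int k)) = S (Suc M) n - E 0 n" for M
      proof -
        have "S M k ** G (int n - int k) = (\<Sum>m<M. E m k ** G (int n - int k))" for k
          unfolding S_def by (rule bounded_bilinear.sum_left[OF bounded_bilinear_matrix_mult])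
        then have "(\<Sum>k. S M k ** G (int n - int k)) = (\<Sum>m<M. \<Sum>k. E m k ** G (int n - int k))"
          using sumE by (simp add: suminf_sum)
        also have "\<dots> = (\<Sum>m<M. E (Suc m) n)" by (simp add: ESuc)
        also have "\<dots> = S (Suc M) n - E 0 n" unfolding S_def by (subst sum.lessThan_Suc_shift) simp
        finally show ?thesis .
      qed
      then show ?thesis using LIMSEQ_Suc[OF SX[of n]] by (simp add: tendsto_diff)
    qed
    ultimately have "(\<Sum>k. X k ** G (int n - int k)) = X n - E 0 n" by (rule LIMSEQ_unique)
    with summable_sums[OF summ] show ?thesis unfolding E0 by simp
  qed
  with XB show ?thesis by (intro exI[of _ X] exI[of _ B] conjI allI)
qed

section \<open>Laurent coefficients\<close>

definition lcoeff :: "(complex \<Rightarrow> complex) \<Rightarrow> int \<Rightarrow> complex" where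
  "lcoeff f n = contour_integral (circlepath 0 1) (\<lambda>u. f u * u powi (- n - 1)) / (2 * of_real pi * \<i>)"

lemma circlepath_efun: "circlepath 0 r t = of_real r * efun 1 t"
  by (simp add: circlepath efun_def)

lemma efun_powi: "efun 1 t powi n = efun n t"
  by (simp add: efun_def exp_power_int mult_ac)

lemma contour_integral_circlepath_efun:
  assumes "r > 0"
  shows "contour_integral (circlepath 0 r) (\<lambda>u. f u * u powi (- n - 1)) =
    2 * of_real pi * \<i> * (of_real r powi (- n) * integral {0..1} (\<lambda>t. f (of_real r * efun 1 t) * efun (- n) t))"
proof -
  have eq: "f (circlepath 0 r t) * circlepath 0 r t powi (- n - 1) * vector_derivative (circlepath 0 r) (at t)
     = 2 * of_real pi * \<i> * of_real r powi (- n) * (f (of_real r * efun 1 t) * efun (- n) t)" for t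
  proof -
    have ne: "efun 1 t \<noteq> 0" using norm_efun[of 1 t] by (metis norm_zero zero_neq_one)
    have "vector_derivative (circlepath 0 r) (at t) = 2 * of_real pi * \<i> * (of_real r * efun 1 t)"
      by (simp add: vector_derivative_circlepath efun_def)
    moreover have "(of_real r * efun 1 t) powi (- n - 1) * (of_real r * efun 1 t) = of_real r powi (- n) * efun (- n) t"
      using assms ne power_int_add_1[of "of_real r * efun 1 t" "- n - 1"]
      by (simp add: power_int_mult_distrib efun_powi)
    ultimately show ?thesis unfolding circlepath_efun by (simp add: mult_ac)
  qed
  show ?thesis
    unfolding contour_integral_integral eq by (simp add: mult.assoc)
qed

text \<open>The contour integral does not depend on the radius, so the Fourier coefficients on a
  circle of radius r are the Laurent coefficients weighted by r^n. This is the bridge between the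
  system on the larger circle and the symbol on the unit circle.\<close>

lemma integral_efun_eq_lcoeff:
  assumes f: "f holomorphic_on annulus a b" and a: "0 \<le> a" "a < 1" "1 < b" and r: "a < r" "r < b"
  shows "integral {0..1} (\<lambda>t. f (of_real r * efun 1 t) * efun (- n) t) = of_real r powi n * lcoeff f n"
proof -
  have "r > 0" using a r by simp
  have "(\<lambda>u. f u * u powi (- n - 1)) holomorphic_on annulus a b"
    using a by (intro holomorphic_intros f) (auto simp: annulus_def)
  from contour_integral_circlepath_annulus[OF this, of r 1]
  have "contour_integral (circlepath 0 r) (\<lambda>u. f u * u powi (- n - 1)) =
        contour_integral (circlepath 0 1) (\<lambda>u. f u * u powi (- n - 1))"
    using a r by simp
  from this[symmetric] have "lcoeff f n = of_real r powi (- n) * integral {0..1} (\<lambda>t. f (of_real r * efun 1 t) * efun (- n) t)"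
    unfolding lcoeff_def contour_integral_circlepath_efun[OF \<open>r > 0\<close>] by simp
  then show ?thesis using \<open>r > 0\<close> by (simp add: power_int_minus)
qed

lemma lcoeff_bound:
  assumes f: "f holomorphic_on annulus a b" and a: "0 \<le> a" "a < 1" "1 < b" and r: "a < r" "r < b"
  shows "\<exists>M\<ge>0. \<forall>n. r powi n * norm (lcoeff f n) \<le> M"
proof -
  have cont: "continuous_on (sphere 0 r) f"
    by (rule continuous_on_subset[OF holomorphic_on_imp_continuous_on[OF f]]) (use r in \<open>auto simp: annulus_def\<close>)
  then have "compact (f ` sphere 0 r)" by (intro compact_continuous_image) auto
  then have "bounded (f ` sphere 0 r)" by (rule compact_imp_bounded)
  then obtain M where M: "M > 0" "\<And>u. u \<in> sphere 0 r \<Longrightarrow> norm (f u) \<le> M"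
    unfolding bounded_pos by auto
  have r0: "r > 0" using a r by simp
  have cont': "continuous_on {0..1} (\<lambda>t. f (of_real r * efun 1 t))"
    by (rule continuous_on_compose2[OF cont]) (use r0 in \<open>auto intro!: continuous_intros simp: norm_mult\<close>)
  have "r powi n * norm (lcoeff f n) \<le> M" for n
  proof -
    have "norm (integral {0..1} (\<lambda>t. f (of_real r * efun 1 t) * efun (- n) t)) \<le> M * (1 - 0)"
      by (rule integral_bound) (use M r0 in \<open>auto simp: norm_mult intro!: continuous_intros cont'\<close>)
    moreover have "norm (of_real r powi n * lcoeff f n) = r powi n * norm (lcoeff f n)"
      using r0 by (simp add: norm_mult norm_power_int)
    ultimately show ?thesis
      using integral_efun_eq_lcoeff[OF assms] by simp
  qed
  then show ?thesis using M(1) by (intro exI[of _ M]) auto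
qed

lemma summable_lcoeff:
  assumes f: "f holomorphic_on annulus a b" and a: "0 \<le> a" "a < 1" "1 < b" and s: "a < s" "s < b"
  shows "summable (\<lambda>k. norm (of_real s powi (int n - int k) * lcoeff f (int n - int k)))"
proof -
  \<comment> \<open>The index n - k tends to minus infinity, so the Cauchy estimate has to be taken
    on a smaller circle, r < s, to give the decay (r / s)^k.\<close>
  define r where "r = (a + s) / 2"
  have r: "a < r" "r < b" "r < s" "0 < r" "0 < s" using a s by (auto simp: r_def)
  obtain M where M: "M \<ge> 0" "\<And>n. r powi n * norm (lcoeff f n) \<le> M"
    using lcoeff_bound[OF f a r(1,2)] by blast
  have "norm (of_real s powi (int n - int k) * lcoeff f (int n - int k)) \<le> M * (s / r) ^ n * (r / s) ^ k" for k
  proof -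
    have "norm (of_real s powi (int n - int k) * lcoeff f (int n - int k))
      = (s / r) powi (int n - int k) * (r powi (int n - int k) * norm (lcoeff f (int n - int k)))"
      using r by (simp add: norm_mult norm_power_int power_int_divide_distrib)
    also have "\<dots> \<le> (s / r) powi (int n - int k) * M"
      using r by (intro mult_left_mono M) auto
    also have "(s / r) powi (int n - int k) = (s / r) ^ n * (r / s) ^ k"
      using r by (simp add: power_int_diff field_simps)
    finally show ?thesis by (simp add: mult_ac)
  qed
  note bd = this
  have "summable (\<lambda>k. M * (s / r) ^ n * (r / s) ^ k)"
    using r by (intro summable_mult summable_geometric) auto
  then show ?thesis
    by (rule summable_comparison_test[rotated]) (use bd in auto)
qed

section \<open>Power series that converge beyond the unit disc\<close>

lemma power_series_geometric_bound:
  fixes x :: "nat \<Rightarrow> complex"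
  assumes x: "\<And>k. norm (x k) \<le> B / s ^ k" and s: "s > 0"
  shows "(\<lambda>w. \<Sum>k. x k * w ^ k) holomorphic_on ball 0 s"
    and "\<And>w. w \<in> ball 0 s \<Longrightarrow> (\<lambda>k. x k * w ^ k) sums (\<Sum>k. x k * w ^ k)"
proof -
  have bd: "norm (x k * w ^ k) \<le> B * (norm w / s) ^ k" for w k
    using mult_right_mono[OF x[of k], of "norm w ^ k"] by (simp add: norm_mult norm_power power_divide)
  show sums: "(\<lambda>k. x k * w ^ k) sums (\<Sum>k. x k * w ^ k)" if "w \<in> ball 0 s" for w
  proof (rule summable_sums, rule summable_comparison_test)
    show "summable (\<lambda>k. B * (norm w / s) ^ k)"
      using that s by (intro summable_mult summable_geometric) auto
  qed (use bd in auto)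
  show "(\<lambda>w. \<Sum>k. x k * w ^ k) holomorphic_on ball 0 s"
    by (rule power_series_holomorphic[where a = x and z = 0, simplified]) (use sums in auto)
qed

text \<open>The infinite version of the convolution rule. Since s > 1, the series converges
  uniformly on the unit circle by the Weierstrass test and may be integrated term by term.\<close>

lemma lcoeff_power_series_mult:
  fixes x :: "nat \<Rightarrow> complex"
  assumes x: "\<And>k. norm (x k) \<le> B / s ^ k" and s: "s > 1" and f: "continuous_on (sphere 0 1) f"
  shows "(\<lambda>k. x k * lcoeff f (n - int k)) sums lcoeff (\<lambda>w. (\<Sum>k. x k * w ^ k) * f w) n"
proof -
  define g where "g w = f w * w powi (- n - 1)" for w
  have g: "continuous_on (sphere 0 1) g"
    unfolding g_def by (intro continuous_intros f) auto
  have B: "B \<ge> 0" using order.trans[OF norm_ge_zero x[of 0]] by simp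
  obtain M where M: "M > 0" "\<And>u. u \<in> sphere 0 1 \<Longrightarrow> norm (g u) \<le> M"
    using compact_imp_bounded[OF compact_continuous_image[OF g compact_sphere]] unfolding bounded_pos by auto
  have int: "(\<lambda>w. x k * w ^ k * g w) contour_integrable_on circlepath 0 1" for k
    by (intro contour_integrable_continuous_circlepath) (auto intro!: continuous_intros g)
  have "uniform_limit (sphere 0 1) (\<lambda>N w. \<Sum>k<N. x k * w ^ k * g w) (\<lambda>w. \<Sum>k. x k * w ^ k * g w) sequentially"
  proof (rule Weierstrass_m_test)
    show "norm (x k * w ^ k * g w) \<le> B * (1 / s) ^ k * M" if "w \<in> sphere 0 1" for k w
      using that M(2)[OF that] x[of k] B M(1) s
      by (simp add: norm_mult norm_power power_one_over mult_mono' divide_inverse power_inverse)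
    show "summable (\<lambda>k. B * (1 / s) ^ k * M)"
      using s by (intro summable_mult summable_mult2 summable_geometric) auto
  qed
  then have "(\<lambda>N. contour_integral (circlepath 0 1) (\<lambda>w. \<Sum>k<N. x k * w ^ k * g w)) \<longlonglongrightarrow>
      contour_integral (circlepath 0 1) (\<lambda>w. \<Sum>k. x k * w ^ k * g w)"
    by (intro contour_integral_uniform_limit_circlepath(2)) (auto intro!: contour_integrable_sum int always_eventually)
  also have "(\<lambda>N. contour_integral (circlepath 0 1) (\<lambda>w. \<Sum>k<N. x k * w ^ k * g w))
      = (\<lambda>N. \<Sum>k<N. contour_integral (circlepath 0 1) (\<lambda>w. x k * w ^ k * g w))"
    using int by (subst contour_integral_sum) auto
  also have "(\<lambda>k. contour_integral (circlepath 0 1) (\<lambda>w. x k * w ^ k * g w))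
      = (\<lambda>k. x k * lcoeff f (n - int k) * (2 * of_real pi * \<i>))"
  proof
    fix k
    have "contour_integral (circlepath 0 1) (\<lambda>w. x k * w ^ k * g w)
        = contour_integral (circlepath 0 1) (\<lambda>w. x k * (f w * w powi (- (n - int k) - 1)))"
    proof (rule contour_integral_cong)
      fix w :: complex assume "w \<in> path_image (circlepath 0 1)"
      then have "w \<noteq> 0" by auto
      then have "w ^ k * w powi (- n - 1) = w powi (- (n - int k) - 1)"
        by (simp add: algebra_simps flip: power_int_add power_int_of_nat)
      then show "x k * w ^ k * g w = x k * (f w * w powi (- (n - int k) - 1))"
        unfolding g_def by (metis mult.assoc mult.left_commute)
    qed simp
    also have "\<dots> = x k * contour_integral (circlepath 0 1) (\<lambda>w. f w * w powi (- (n - int k) - 1))"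
      by (intro contour_integral_lmul contour_integrable_continuous_circlepath continuous_intros)
         (use f in auto)
    finally show "contour_integral (circlepath 0 1) (\<lambda>w. x k * w ^ k * g w)
        = x k * lcoeff f (n - int k) * (2 * of_real pi * \<i>)"
      by (simp add: lcoeff_def)
  qed
  finally have "(\<lambda>k. x k * lcoeff f (n - int k) * (2 * of_real pi * \<i>)) sums
      contour_integral (circlepath 0 1) (\<lambda>w. \<Sum>k. x k * w ^ k * g w)"
    unfolding sums_def .
  from sums_divide[OF this, of "2 * of_real pi * \<i>"]
  have "(\<lambda>k. x k * lcoeff f (n - int k)) sums
      (contour_integral (circlepath 0 1) (\<lambda>w. \<Sum>k. x k * w ^ k * g w) / (2 * of_real pi * \<i>))" by simp
  also have "contour_integral (circlepath 0 1) (\<lambda>w. \<Sum>k. x k * w ^ k * g w)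
     = contour_integral (circlepath 0 1) (\<lambda>w. (\<Sum>k. x k * w ^ k) * f w * w powi (- n - 1))"
  proof (rule contour_integral_cong)
    fix w :: complex assume "w \<in> path_image (circlepath 0 1)"
    then have "w \<in> ball 0 s" using s by auto
    from sums_mult2[OF power_series_geometric_bound(2)[OF x _ this], of "g w"] s
    have "(\<Sum>k. x k * w ^ k * g w) = (\<Sum>k. x k * w ^ k) * g w" by (simp add: sums_iff)
    then show "(\<Sum>k. x k * w ^ k * g w) = (\<Sum>k. x k * w ^ k) * f w * w powi (- n - 1)" by (simp add: g_def)
  qed simp
  finally show ?thesis by (simp only: lcoeff_def)
qed

lemma analytic_on_cball_imp_ball:
  assumes "f analytic_on cball 0 1"
  shows "\<exists>R>1. f holomorphic_on ball (0::complex) R"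
proof -
  obtain U where U: "open U" "cball 0 1 \<subseteq> U" "f holomorphic_on U"
    using assms by (auto simp: analytic_on_holomorphic)
  obtain e where e: "e > 0" "(\<Union>x\<in>cball 0 1. ball x e) \<subseteq> U"
    using compact_subset_open_imp_ball_epsilon_subset[OF compact_cball U(1,2)] by blast
  have "ball 0 (1 + e) \<subseteq> U"
  proof
    fix z :: complex assume z: "z \<in> ball 0 (1 + e)"
    show "z \<in> U"
    proof (cases "norm z \<le> 1")
      case True
      then show ?thesis using U(2) by auto
    next
      case False
      then have "z \<noteq> 0" by auto
      have "z \<in> ball (z / of_real (norm z)) e"
        using z False dist_radial_projection[OF \<open>z \<noteq> 0\<close>] by auto
      moreover have "z / of_real (norm z) \<in> cball 0 1"
        using \<open>z \<noteq> 0\<close> by (simp add: norm_divide)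
      ultimately show "z \<in> U" using e(2) by blast
    qed
  qed
  then show ?thesis
    using e(1) U(3) by (intro exI[of _ "1 + e"]) (auto intro: holomorphic_on_subset)
qed

lemma lcoeff_eq_integral: "lcoeff f n = integral {0..1} (\<lambda>t. f (efun 1 t) * efun (- n) t)"
  unfolding lcoeff_def contour_integral_circlepath_efun[OF zero_less_one] by simp

lemma lcoeff_cnj:
  assumes "\<And>w. norm w = 1 \<Longrightarrow> g w = cnj (f w)"
  shows "lcoeff g (- n) = cnj (lcoeff f n)"
  unfolding lcoeff_eq_integral by (simp add: assms integral_cnj)

lemma lcoeff_sum:
  assumes "\<And>l. l \<in> L \<Longrightarrow> continuous_on (sphere 0 1) (f l)"
  shows "lcoeff (\<lambda>w. \<Sum>l\<in>L. f l w) n = (\<Sum>l\<in>L. lcoeff (f l) n)"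
proof -
  have "continuous_on {0..1} (\<lambda>t. f l (efun 1 t))" if "l \<in> L" for l
    by (rule continuous_on_compose2[OF assms[OF that]]) (auto intro: continuous_intros)
  then show ?thesis
    unfolding lcoeff_eq_integral sum_distrib_right
    by (cases "finite L") (auto intro!: integral_sum integrable_continuous_interval continuous_intros)
qed

text \<open>On the circle g has only nonnegative frequencies, and as a conjugate of f only
  nonpositive ones. Hence all derivatives of g of positive order vanish at 0.\<close>

lemma analytic_disc_conj_constant:
  assumes f: "f analytic_on cball 0 1" and g: "g analytic_on cball 0 1"
    and fg: "\<And>w. norm w = 1 \<Longrightarrow> g w = cnj (f w)" and w: "norm w \<le> 1"
  shows "g w = g 0"
proof -
  obtain R where R: "R > 1" "g holomorphic_on ball 0 R"
    using analytic_on_cball_imp_ball[OF g] by blast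
  obtain R' where R': "R' > 1" "f holomorphic_on ball 0 R'"
    using analytic_on_cball_imp_ball[OF f] by blast
  show ?thesis
  proof (rule holomorphic_fun_eq_const_on_connected[OF R(2)])
    fix n :: nat assume n: "0 < n"
    have "contour_integral (circlepath 0 1) (\<lambda>u. f u * u ^ (n - 1)) = 0"
    proof (rule contour_integral_unique, rule Cauchy_theorem_disc_simple[of _ 0 R'])
      show "(\<lambda>u. f u * u ^ (n - 1)) holomorphic_on ball 0 R'"
        by (intro holomorphic_intros R')
    qed (use R' in auto)
    moreover have "u ^ (n - 1) = u powi (- (- int n) - 1)" for u :: complex
      using n by (simp add: of_nat_diff flip: power_int_of_nat)
    ultimately have "lcoeff f (- int n) = 0" by (simp add: lcoeff_def)
    then have "lcoeff g (int n) = 0" using lcoeff_cnj[of g f "- int n"] fg by simp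
    moreover have "contour_integral (circlepath 0 1) (\<lambda>u. g u / (u - 0) ^ Suc n) =
        contour_integral (circlepath 0 1) (\<lambda>u. g u * u powi (- int n - 1))"
    proof (rule contour_integral_cong)
      fix u :: complex assume "u \<in> path_image (circlepath 0 1)"
      have "- int n - 1 = - int (Suc n)" by simp
      then have "u powi (- int n - 1) = inverse (u ^ Suc n)"
        by (simp only: power_int_minus power_int_of_nat)
      then show "g u / (u - 0) ^ Suc n = g u * u powi (- int n - 1)"
        by (simp only: divide_inverse diff_zero)
    qed simp
    ultimately have "contour_integral (circlepath 0 1) (\<lambda>u. g u / (u - 0) ^ Suc n) = 0"
      by (simp add: lcoeff_def)
    moreover have "contour_integral (circlepath 0 1) (\<lambda>u. g u / (u - 0) ^ Suc n) = (2 * pi * \<i>) * (deriv ^^ n) g 0 / fact n"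
      by (rule Cauchy_contour_integral_circlepath)
         (use R in \<open>auto intro: holomorphic_on_subset continuous_on_subset[OF holomorphic_on_imp_continuous_on]\<close>)
    ultimately show "(deriv ^^ n) g 0 = 0" by simp
  qed (use R w in auto)
qed

section \<open>Factorization of positive definite symbols\<close>

text \<open>The conjugated rows of A serve as test vectors. This turns positivity of M into
  coercivity of right multiplication by M, and the identity does not need M to be Hermitian.\<close>

lemma inner_matrix_mult_eq_hform:
  fixes A M :: "complex^'n^'n"
  shows "inner A (A ** M) = (\<Sum>i\<in>UNIV. Re (hform M (\<chi> j. cnj (A $ i $ j))))"
proof -
  have "inner A (A ** M) = (\<Sum>i\<in>UNIV. \<Sum>j\<in>UNIV. Re (cnj (A $ i $ j) * (A ** M) $ i $ j))"
    by (simp add: inner_vec_def inner_complex_def)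
  also have "\<dots> = (\<Sum>i\<in>UNIV. Re (\<Sum>j\<in>UNIV. \<Sum>l\<in>UNIV. A $ i $ l * M $ l $ j * cnj (A $ i $ j)))"
    by (simp add: matrix_matrix_mult_def sum_distrib_left mult_ac)
  also have "\<dots> = (\<Sum>i\<in>UNIV. Re (hform M (\<chi> j. cnj (A $ i $ j))))"
    unfolding hform_def by (subst sum.swap) simp
  finally show ?thesis .
qed

lemma inner_matrix_mult_pos:
  fixes A M :: "complex^'n^'n"
  assumes M: "psd M" "invertible M" and A: "A \<noteq> 0"
  shows "0 < inner A (A ** M)"
proof -
  obtain i where "A $ i \<noteq> 0" using A by (metis vec_eq_iff zero_index)
  then have "(\<chi> j. cnj (A $ i $ j)) \<noteq> 0" by (auto simp: vec_eq_iff)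
  then show ?thesis
    unfolding inner_matrix_mult_eq_hform
    by (intro sum_pos2[of _ i] psd_pos M) (use M in \<open>auto simp: psd_def\<close>)
qed

text \<open>The form is continuous and positive on the compact product of the circle and the unit
  sphere of matrices; homogeneity in A extends its minimum to all matrices.\<close>

lemma uniform_positivity_on_circle:
  fixes F :: "complex \<Rightarrow> complex^'n^'n"
  assumes F: "continuous_on (sphere 0 1) F"
    and pos: "\<And>w. norm w = 1 \<Longrightarrow> psd (F w) \<and> invertible (F w)"
  shows "\<exists>c>0. \<forall>w (A :: complex^'n^'n). norm w = 1 \<longrightarrow> c * (norm A)\<^sup>2 \<le> inner A (A ** F w)"
proof -
  define \<phi> where "\<phi> = (\<lambda>(w, A::complex^'n^'n). inner A (A ** F w))"
  obtain A0 :: "complex^'n^'n" where A0: "norm A0 = 1"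
    using vector_choose_size[of 1] by auto
  have "compact (sphere (0::complex) 1 \<times> sphere (0::complex^'n^'n) 1)" by (intro compact_Times) auto
  moreover have "sphere (0::complex) 1 \<times> sphere (0::complex^'n^'n) 1 \<noteq> {}"
    using A0 norm_one by (auto simp: ex_in_conv[symmetric] intro!: exI[of _ "(1, A0)"])
  moreover have "continuous_on (sphere (0::complex) 1 \<times> sphere (0::complex^'n^'n) 1) \<phi>"
    unfolding \<phi>_def case_prod_beta
    by (intro continuous_intros bounded_bilinear.continuous_on[OF bounded_bilinear_matrix_mult]
        continuous_on_compose2[OF F]) auto
  ultimately obtain p where p: "p \<in> sphere 0 1 \<times> sphere 0 1"
      "\<And>y. y \<in> sphere 0 1 \<times> sphere 0 1 \<Longrightarrow> \<phi> p \<le> \<phi> y"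
    using continuous_attains_inf by metis
  have "\<phi> p > 0"
    using p(1) pos inner_matrix_mult_pos[of "F (fst p)" "snd p"] by (cases p, cases "snd p = 0") (auto simp: \<phi>_def)
  moreover have "\<phi> p * (norm A)\<^sup>2 \<le> inner A (A ** F w)" if w: "norm w = 1" for w and A :: "complex^'n^'n"
  proof (cases "A = 0")
    case True
    then show ?thesis by simp
  next
    case False
    define U where "U = (1 / norm A) *\<^sub>R A"
    have U: "norm U = 1" "A = norm A *\<^sub>R U" using False by (auto simp: U_def)
    have "norm A *\<^sub>R U ** F w = norm A *\<^sub>R (U ** F w)"
      by (rule bounded_bilinear.scaleR_left[OF bounded_bilinear_matrix_mult])
    then have "inner A (A ** F w) = (norm A)\<^sup>2 * inner U (U ** F w)"
      by (subst (1 2) U(2)) (simp add: power2_eq_square)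
    moreover have "\<phi> p \<le> inner U (U ** F w)"
      using p(2)[of "(w, U)"] w U by (simp add: \<phi>_def)
    ultimately show ?thesis
      by (simp add: mult.commute mult_right_mono)
  qed
  ultimately show ?thesis by blast
qed

text \<open>Between a point of radius s and its radial projection F changes by less than c / 2 once
  s is close to 1, which costs at most half of the coercivity constant.\<close>

lemma positivity_on_larger_circle:
  fixes F :: "complex \<Rightarrow> complex^'n^'n"
  assumes F: "continuous_on (annulus a b) F" and ab: "a < 1" "1 < b"
    and pos: "\<And>w. norm w = 1 \<Longrightarrow> psd (F w) \<and> invertible (F w)"
  shows "\<exists>s c. 1 < s \<and> s < b \<and> 0 < c \<and> (\<forall>w (A :: complex^'n^'n). norm w = s \<longrightarrow> c * (norm A)\<^sup>2 \<le> inner A (A ** F w))"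
proof -
  have "continuous_on (sphere 0 1) F"
    by (rule continuous_on_subset[OF F]) (use ab in \<open>auto simp: annulus_def\<close>)
  then obtain c where c: "c > 0" "\<And>w (A :: complex^'n^'n). norm w = 1 \<Longrightarrow> c * (norm A)\<^sup>2 \<le> inner A (A ** F w)"
    using uniform_positivity_on_circle[of F] pos by blast
  define b' where "b' = (1 + b) / 2"
  have b': "1 < b'" "b' < b" using ab by (auto simp: b'_def)
  define K where "K = cball 0 b' - ball (0::complex) 1"
  have "compact K" unfolding K_def by (intro compact_diff) auto
  moreover have "continuous_on K F"
    by (rule continuous_on_subset[OF F]) (use ab b' in \<open>auto simp: annulus_def K_def\<close>)
  ultimately have "uniformly_continuous_on K F" by (intro compact_uniformly_continuous)
  then obtain d where d: "d > 0" "\<And>x y. x \<in> K \<Longrightarrow> y \<in> K \<Longrightarrow> dist y x < d \<Longrightarrow> dist (F y) (F x) < c / 2"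
    unfolding uniformly_continuous_on_def using c(1) by (metis half_gt_zero)
  define s where "s = min (1 + d / 2) b'"
  have s: "1 < s" "s \<le> b'" "s < 1 + d" using d b' by (auto simp: s_def)
  have "c / 2 * (norm A)\<^sup>2 \<le> inner A (A ** F w)" if w: "norm w = s" for w and A :: "complex^'n^'n"
  proof -
    define u where "u = w / of_real s"
    have u: "norm u = 1" using w s by (simp add: u_def norm_divide)
    have "w - u = u * of_real (s - 1)" using s by (simp add: u_def field_simps)
    then have "norm (w - u) = s - 1" using u s by (simp only: norm_mult norm_of_real) simp
    then have "norm (F w - F u) < c / 2"
      using d(2)[of u w] u w s b' by (auto simp: K_def dist_norm)
    then have "norm A * (norm A * norm (F w - F u)) \<le> norm A * (norm A * (c / 2))"
      by (intro mult_left_mono) auto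
    moreover have "\<bar>inner A (A ** (F w - F u))\<bar> \<le> norm A * (norm A * norm (F w - F u))"
      by (rule order.trans[OF Cauchy_Schwarz_ineq2]) (intro mult_left_mono norm_matrix_mult_le norm_ge_zero)
    moreover have "inner A (A ** (F w - F u)) = inner A (A ** F w) - inner A (A ** F u)"
      by (simp add: bounded_bilinear.diff_right[OF bounded_bilinear_matrix_mult] inner_diff_right)
    ultimately show ?thesis using c(2)[OF u, of A] by (simp add: power2_eq_square algebra_simps)
  qed
  then show ?thesis using s c(1) b' by (intro exI[of _ s] exI[of _ "c / 2"]) auto
qed

section \<open>Solving the half-line system for a positive symbol\<close>

definition mat_lcoeff :: "(complex \<Rightarrow> complex^'n^'n) \<Rightarrow> int \<Rightarrow> complex^'n^'n" where
  "mat_lcoeff F n = (\<chi> i j. lcoeff (\<lambda>w. F w $ i $ j) n)"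

lemma norm_matrix_le_sum: "norm A \<le> (\<Sum>i\<in>UNIV. \<Sum>j\<in>UNIV. norm (A $ i $ j))" for A :: "complex^'n^'m"
proof -
  have "norm A \<le> (\<Sum>i\<in>UNIV. norm (A $ i))" unfolding norm_vec_def by (rule L2_set_le_sum) simp
  also have "\<dots> \<le> (\<Sum>i\<in>UNIV. \<Sum>j\<in>UNIV. norm (A $ i $ j))"
    by (intro sum_mono) (simp add: norm_vec_def L2_set_le_sum)
  finally show ?thesis .
qed

lemma continuous_on_matrix:
  assumes "\<And>i j. continuous_on S (\<lambda>x. F x $ i $ j)"
  shows "continuous_on S (F :: _ \<Rightarrow> complex^'n^'m)"
proof -
  have "continuous_on S (\<lambda>x. \<chi> i. \<chi> j. F x $ i $ j)"
    by (intro continuous_on_vec_lambda assms)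
  then show ?thesis by simp
qed

lemma fcoeff_circle:
  fixes F :: "complex \<Rightarrow> complex^'n^'n"
  assumes F: "\<And>i j. (\<lambda>w. F w $ i $ j) holomorphic_on annulus a b"
    and ab: "0 \<le> a" "a < 1" "1 < b" and s: "a < s" "s < b"
  shows "fcoeff (\<lambda>t. F (of_real s * efun 1 t)) n = s powi n *\<^sub>R mat_lcoeff F n"
  by (simp add: fcoeff_def mat_lcoeff_def vec_eq_iff integral_efun_eq_lcoeff[OF F ab s] scaleR_conv_of_real[where 'a = complex]
      of_real_power_int)

lemma summable_mat_lcoeff:
  fixes F :: "complex \<Rightarrow> complex^'n^'n"
  assumes F: "\<And>i j. (\<lambda>w. F w $ i $ j) holomorphic_on annulus a b"
    and ab: "0 \<le> a" "a < 1" "1 < b" and s: "a < s" "s < b"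
  shows "summable (\<lambda>k. norm (s powi (int n - int k) *\<^sub>R mat_lcoeff F (int n - int k)))"
proof (rule summable_comparison_test)
  have "summable (\<lambda>k. norm (of_real s powi (int n - int k) * lcoeff (\<lambda>w. F w $ i $ j) (int n - int k)))" for i j
    by (rule summable_lcoeff[OF F ab s])
  then show "summable (\<lambda>k. \<Sum>i\<in>UNIV. \<Sum>j\<in>UNIV. norm (of_real s powi (int n - int k) * lcoeff (\<lambda>w. F w $ i $ j) (int n - int k)))"
    by (intro summable_sum)
  show "\<exists>N. \<forall>k\<ge>N. norm (norm (s powi (int n - int k) *\<^sub>R mat_lcoeff F (int n - int k))) \<le>
      (\<Sum>i\<in>UNIV. \<Sum>j\<in>UNIV. norm (of_real s powi (int n - int k) * lcoeff (\<lambda>w. F w $ i $ j) (int n - int k)))"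
    using norm_matrix_le_sum[of "s powi (int n - int k) *\<^sub>R mat_lcoeff F (int n - int k)" for k]
    by (auto simp: mat_lcoeff_def scaleR_conv_of_real[where 'a = complex] of_real_power_int)
qed

text \<open>Expanding the square with step \<tau> bounds the left side by (1 - 2 \<tau> c + \<tau>^2
  C^2) times the squared norm of A. The step \<tau> = c / C^2 minimises this factor.\<close>

lemma richardson_contraction:
  fixes A M :: "complex^'n^'n"
  assumes c: "c * (norm A)\<^sup>2 \<le> inner A (A ** M)" and C: "norm M \<le> C" "0 < C" and "0 < c"
  shows "(norm (A ** (mat 1 - (c / C\<^sup>2) *\<^sub>R M)))\<^sup>2 \<le> (1 - (c / C)\<^sup>2) * (norm A)\<^sup>2"
proof -
  define \<tau> where "\<tau> = c / C\<^sup>2"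
  have \<tau>: "\<tau> > 0" using assms by (simp add: \<tau>_def)
  have eq: "A ** (mat 1 - \<tau> *\<^sub>R M) = A - \<tau> *\<^sub>R (A ** M)"
    by (simp add: bounded_bilinear.diff_right[OF bounded_bilinear_matrix_mult]
        bounded_bilinear.scaleR_right[OF bounded_bilinear_matrix_mult])
  have "(norm (A ** (mat 1 - \<tau> *\<^sub>R M)))\<^sup>2 = (norm A)\<^sup>2 - 2 * \<tau> * inner A (A ** M) + \<tau>\<^sup>2 * (norm (A ** M))\<^sup>2"
    unfolding eq power2_norm_eq_inner inner_diff_left inner_diff_right inner_scaleR_left inner_scaleR_right
      inner_commute[of "A ** M" A]
    by (simp add: power2_eq_square algebra_simps)
  moreover have "2 * \<tau> * (c * (norm A)\<^sup>2) \<le> 2 * \<tau> * inner A (A ** M)"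
    using \<tau> by (intro mult_left_mono c) auto
  moreover have "\<tau>\<^sup>2 * (norm (A ** M))\<^sup>2 \<le> \<tau>\<^sup>2 * (norm A * C)\<^sup>2"
    using C by (intro mult_left_mono power_mono order.trans[OF norm_matrix_mult_le]) auto
  ultimately have "(norm (A ** (mat 1 - \<tau> *\<^sub>R M)))\<^sup>2 \<le> (norm A)\<^sup>2 - 2 * \<tau> * (c * (norm A)\<^sup>2) + \<tau>\<^sup>2 * (norm A * C)\<^sup>2"
    by linarith
  also have "\<dots> = (1 - (c / C)\<^sup>2) * (norm A)\<^sup>2"
    using C by (simp add: \<tau>_def power2_eq_square field_simps)
  finally show ?thesis unfolding \<tau>_def .
qed

text \<open>On the circle of radius s the symbol 1 - \<tau> F is a contraction, and the Neumann
  series inverts the Toeplitz operator of \<tau> F there. The weight s^(n - k) of the Laurent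
  coefficients then splits between unknowns and equations.\<close>

lemma Toeplitz_system_solution:
  fixes F :: "complex \<Rightarrow> complex^'n^'n"
  assumes F: "\<And>i j. (\<lambda>w. F w $ i $ j) holomorphic_on annulus a b"
    and ab: "0 \<le> a" "a < 1" "1 < b"
    and pos: "\<And>w. norm w = 1 \<Longrightarrow> psd (F w) \<and> invertible (F w)"
  shows "\<exists>s B X. 1 < s \<and> (\<forall>k. norm (X k) \<le> B / s ^ k) \<and>
    (\<forall>n. (\<lambda>k. X k ** mat_lcoeff F (int n - int k)) sums (if n = 0 then mat 1 else 0))"
proof -
  have contF: "continuous_on (annulus a b) F"
    by (intro continuous_on_matrix holomorphic_on_imp_continuous_on F)
  obtain s c where s: "1 < s" "s < b" and c: "0 < c"
    and pd: "\<And>w (A :: complex^'n^'n). norm w = s \<Longrightarrow> c * (norm A)\<^sup>2 \<le> inner A (A ** F w)"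
    using positivity_on_larger_circle[OF contF ab(2,3)] pos by blast
  have as: "a < s" using s ab by simp
  have contS: "continuous_on (sphere 0 s) F"
    by (rule continuous_on_subset[OF contF]) (use s ab in \<open>auto simp: annulus_def\<close>)
  obtain C where C: "C > c" "\<And>w. norm w = s \<Longrightarrow> norm (F w) \<le> C"
  proof -
    obtain C where C: "\<forall>x\<in>F ` sphere 0 s. norm x \<le> C"
      using compact_imp_bounded[OF compact_continuous_image[OF contS compact_sphere]] unfolding bounded_iff by blast
    \<comment> \<open>The maximum with c + 1 forces C > c, which puts the radicand in
      \<open>q\<close> strictly between 0 and 1.\<close>
    have "norm (F w) \<le> max C (c + 1)" if "norm w = s" for w
      using C that by (force simp: le_max_iff_disj)
    then show ?thesis using that[of "max C (c + 1)"] by simp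
  qed
  define \<tau> where "\<tau> = c / C\<^sup>2"
  have \<tau>: "\<tau> > 0" using c C by (simp add: \<tau>_def)
  define f where "f t = F (of_real s * efun 1 t)" for t
  define g where "g t = mat 1 - \<tau> *\<^sub>R f t" for t
  define q where "q = sqrt (1 - (c / C)\<^sup>2)"
  have "(c / C)\<^sup>2 < 1" "0 < (c / C)\<^sup>2" using c C by (auto simp: power_less_one_iff abs_square_less_1)
  then have q: "0 \<le> q" "q < 1" "q\<^sup>2 = 1 - (c / C)\<^sup>2" by (auto simp: q_def)
  have f: "continuous_on {0..1} f"
    unfolding f_def by (rule continuous_on_compose2[OF contS]) (use s in \<open>auto simp: norm_mult intro!: continuous_intros\<close>)
  have g: "continuous_on {0..1} g"
    unfolding g_def by (intro continuous_intros f)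
  have contr: "(norm (A ** g t))\<^sup>2 \<le> q\<^sup>2 * (norm A)\<^sup>2" for A :: "complex^'n^'n" and t
    unfolding q(3) g_def \<tau>_def f_def using c C s by (intro richardson_contraction pd C) (auto simp: norm_mult)
  have fc: "fcoeff f n = s powi n *\<^sub>R mat_lcoeff F n" for n
    unfolding f_def by (rule fcoeff_circle[OF F ab as s(2)])
  have gc: "fcoeff g n = (if n = 0 then mat 1 else 0) - \<tau> *\<^sub>R fcoeff f n" for n
  proof -
    have "((\<lambda>t. (mat 1 :: complex^'n^'n) $ i $ j * efun (- n) t - \<tau> *\<^sub>R (f t $ i $ j * efun (- n) t)) has_integral
       (mat 1 :: complex^'n^'n) $ i $ j * (if - n = 0 then 1 else 0) - \<tau> *\<^sub>R fcoeff f n $ i $ j) {0..1}" for i j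
      unfolding fcoeff_def vec_lambda_beta
      by (intro has_integral_diff has_integral_mult_right integral_efun has_integral_cmul integrable_integral
            integrable_continuous_interval continuous_intros f)
    then have "fcoeff g n $ i $ j = (mat 1 :: complex^'n^'n) $ i $ j * (if - n = 0 then 1 else 0) - \<tau> *\<^sub>R fcoeff f n $ i $ j" for i j
      unfolding fcoeff_def[of g] vec_lambda_beta g_def by (intro integral_unique) (simp add: left_diff_distrib)
    then show ?thesis by (simp add: vec_eq_iff)
  qed
  have smf: "summable (\<lambda>k. norm (fcoeff f (int n - int k)))" for n
    unfolding fc by (rule summable_mat_lcoeff[OF F ab as s(2)])
  have smg: "summable (\<lambda>k. norm (fcoeff g (int n - int k)))" for n
  proof (rule summable_comparison_test)
    show "summable (\<lambda>k. (if k = n then norm (mat 1 :: complex^'n^'n) else 0) + \<tau> * norm (fcoeff f (int n - int k)))"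
      by (intro summable_add summable_mult smf) (rule summable_finite[of "{n}"], auto)
    show "\<exists>N. \<forall>k\<ge>N. norm (norm (fcoeff g (int n - int k))) \<le>
        (if k = n then norm (mat 1 :: complex^'n^'n) else 0) + \<tau> * norm (fcoeff f (int n - int k))"
      using \<tau> norm_triangle_ineq4[of "mat 1" "\<tau> *\<^sub>R fcoeff f 0"] by (auto simp: gc)
  qed
  obtain X B where XB: "\<And>n. norm (X n) \<le> B"
    and X: "\<And>n. (\<lambda>k. X k ** fcoeff g (int n - int k)) sums (X n - (if n = 0 then mat 1 else 0))"
    using Toeplitz_Neumann_series[OF smg Toeplitz_contraction_finite[OF g contr] q(1,2)] by blast
  \<comment> \<open>The factor s^(-k) is where a bounded solution on the larger circle becomes a
    geometrically decaying one. The matching factor s^n is divided out of the n-th equation, whose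
    right side is nonzero only for n = 0.\<close>
  define Y where "Y k = (\<tau> / s ^ k) *\<^sub>R X k" for k
  have "norm (Y k) \<le> \<tau> * B / s ^ k" for k
    using XB[of k] \<tau> s by (simp add: Y_def divide_right_mono mult_left_mono)
  moreover have "(\<lambda>k. Y k ** mat_lcoeff F (int n - int k)) sums (if n = 0 then mat 1 else 0)" for n
  proof -
    have "(\<lambda>k. if k = n then X k else 0) sums X n" by (rule sums_single)
    from sums_diff[OF this X[of n]]
    have "(\<lambda>k. (if k = n then X k else 0) - X k ** fcoeff g (int n - int k)) sums (if n = 0 then mat 1 else 0)"
      by simp
    from bounded_linear.sums[OF bounded_linear_scaleR_right[of "1 / s ^ n"] this]
    have "(\<lambda>k. (1 / s ^ n) *\<^sub>R ((if k = n then X k else 0) - X k ** fcoeff g (int n - int k))) sums (if n = 0 then mat 1 else 0)"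
      by (simp add: if_distrib cong: if_cong)
    also have "(\<lambda>k. (1 / s ^ n) *\<^sub>R ((if k = n then X k else 0) - X k ** fcoeff g (int n - int k)))
        = (\<lambda>k. Y k ** mat_lcoeff F (int n - int k))"
    proof
      fix k
      have "(if k = n then X k else 0) - X k ** fcoeff g (int n - int k) = \<tau> *\<^sub>R (X k ** fcoeff f (int n - int k))"
        unfolding gc by (simp add: bounded_bilinear.diff_right[OF bounded_bilinear_matrix_mult]
            bounded_bilinear.scaleR_right[OF bounded_bilinear_matrix_mult]
            bounded_bilinear.zero_right[OF bounded_bilinear_matrix_mult])
      then show "(1 / s ^ n) *\<^sub>R ((if k = n then X k else 0) - X k ** fcoeff g (int n - int k))
          = Y k ** mat_lcoeff F (int n - int k)"
        using s by (simp add: fc Y_def power_int_diff bounded_bilinear.scaleR_right[OF bounded_bilinear_matrix_mult]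
            bounded_bilinear.scaleR_left[OF bounded_bilinear_matrix_mult])
    qed
    finally show ?thesis .
  qed
  ultimately show ?thesis using s(1) by blast
qed

lemma mat_analytic_on_circle_imp_annulus:
  fixes F :: "complex \<Rightarrow> complex^'n^'n"
  assumes "mat_analytic_on F (sphere 0 1)"
  shows "\<exists>a b. 0 < a \<and> a < 1 \<and> 1 < b \<and> (\<forall>i j. (\<lambda>w. F w $ i $ j) holomorphic_on annulus a b)"
proof -
  have "\<forall>p. \<exists>e>0. (\<lambda>w. F w $ fst p $ snd p) holomorphic_on annulus (1 - e) (1 + e)"
    using assms analytic_on_circle_imp_annulus unfolding mat_analytic_on_def by blast
  then obtain e where e: "\<And>p. e p > 0" "\<And>p. (\<lambda>w. F w $ fst p $ snd p) holomorphic_on annulus (1 - e p) (1 + e p)"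
    by metis
  \<comment> \<open>The cap 1/2 keeps the inner radius positive, as the reflection w -> 1 / cnj w
    requires.\<close>
  define d where "d = min (1/2) (Min (range e))"
  have d: "d > 0" "d \<le> 1/2" "\<And>p. d \<le> e p" using e(1) by (auto simp: d_def min_le_iff_disj)
  have "(\<lambda>w. F w $ i $ j) holomorphic_on annulus (1 - d) (1 + d)" for i j
    using e(2)[of "(i, j)"] d(3)[of "(i, j)"] by (auto simp: annulus_def elim!: holomorphic_on_subset)
  then show ?thesis using d by (intro exI[of _ "1 - d"] exI[of _ "1 + d"]) auto
qed

lemma mat_analytic_on_mult:
  assumes "mat_analytic_on F S" "mat_analytic_on G S"
  shows "mat_analytic_on (\<lambda>w. F w ** G w) S"
  using assms unfolding mat_analytic_on_def matrix_matrix_mult_def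
  by (auto intro!: analytic_intros)

lemma mat_analytic_on_const: "mat_analytic_on (\<lambda>w. A) S"
  unfolding mat_analytic_on_def by (auto intro!: analytic_intros)

lemma mat_analytic_on_imp_continuous_on:
  assumes "mat_analytic_on F S"
  shows "continuous_on S F"
  using assms unfolding mat_analytic_on_def
  by (intro continuous_on_matrix) (meson analytic_imp_holomorphic holomorphic_on_imp_continuous_on)

text \<open>On the circle \<open>1 / cnj w = w\<close>; this reflection makes the adjoint of an analytic function analytic.\<close>

lemma reflection_holomorphic:
  assumes f: "f holomorphic_on annulus a b" and ab: "0 < a" "a < 1" "1 < b"
  shows "(\<lambda>w. cnj (f (1 / cnj w))) holomorphic_on annulus (1 / b) (1 / a)"
proof -
  have "cnj ` annulus a b = annulus a b"
  proof -
    have "w \<in> cnj ` annulus a b" if "w \<in> annulus a b" for w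
      by (rule image_eqI[of _ _ "cnj w"]) (use that in \<open>auto simp: annulus_def\<close>)
    then show ?thesis by (auto simp: annulus_def)
  qed
  then have 1: "(cnj \<circ> f \<circ> cnj) holomorphic_on annulus a b"
    using f by (intro holomorphic_on_compose_cnj_cnj open_annulus) simp
  have 2: "(\<lambda>w. 1 / w) holomorphic_on annulus (1 / b) (1 / a)"
    using ab by (intro holomorphic_intros) (auto simp: annulus_def)
  have 3: "(\<lambda>w. 1 / w) ` annulus (1 / b) (1 / a) \<subseteq> annulus a b"
    using ab by (auto simp: annulus_def norm_divide divide_simps mult.commute)
  from holomorphic_on_compose_gen[OF 2 1 3] show ?thesis by (simp add: o_def)
qed

text \<open>The hypothesis leaves P only nonpositive frequencies, so its adjoint on the circle has
  only nonnegative ones and mean 1. The reflected entries are holomorphic on an annulus, where the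
  extension criterion by moments applies.\<close>

lemma adjoint_extension_to_disc:
  fixes P :: "complex \<Rightarrow> complex^'n^'n"
  assumes P: "\<And>i j. (\<lambda>w. P w $ i $ j) holomorphic_on annulus a b" and ab: "0 < a" "a < 1" "1 < b"
    and coeff: "\<And>n::nat. mat_lcoeff P (int n) = (if n = 0 then mat 1 else 0)"
  shows "\<exists>K. mat_analytic_on K (cball 0 1) \<and> (\<forall>w\<in>sphere 0 1. K w = cadjoint (P w)) \<and> K 0 = mat 1"
proof -
  have "\<exists>h. h analytic_on cball 0 1 \<and> (\<forall>w\<in>sphere 0 1. h w = cnj (P w $ j $ i)) \<and> h 0 = mat 1 $ i $ j" for i j
  proof -
    define \<phi> where "\<phi> w = cnj (P (1 / cnj w) $ j $ i)" for w
    have \<phi>: "\<phi> holomorphic_on annulus (1 / b) (1 / a)"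
      unfolding \<phi>_def by (rule reflection_holomorphic[OF P ab])
    have circ: "\<phi> w = cnj (P w $ j $ i)" if "norm w = 1" for w
    proof -
      have "w * cnj w = 1" using that by (simp flip: complex_norm_square)
      then have "1 / cnj w = w" using that by (metis nonzero_eq_divide_eq complex_cnj_zero_iff mult_zero_right zero_neq_one)
      then show ?thesis by (simp add: \<phi>_def)
    qed
    have lc: "lcoeff \<phi> (- int n) = (if n = 0 then mat 1 $ i $ j else 0)" for n
      using lcoeff_cnj[of \<phi> "\<lambda>w. P w $ j $ i" "int n"] circ coeff[of n]
      by (auto simp: mat_lcoeff_def vec_eq_iff mat_def)
    \<comment> \<open>The n-th moment is the coefficient of index -(n + 1), hence the shift by
      one.\<close>
    have mom: "contour_integral (circlepath 0 1) (\<lambda>u. \<phi> u * u ^ n) = 0" for n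
      using lc[of "Suc n"] by (simp add: lcoeff_def)
    have "1 / b < 1" "1 < 1 / a" using ab by auto
    then obtain h where "h analytic_on cball 0 1" "\<forall>w\<in>sphere 0 1. h w = \<phi> w"
        "h 0 = contour_integral (circlepath 0 1) (\<lambda>u. \<phi> u / u) / (2 * of_real pi * \<i>)"
      using holomorphic_extension_to_disc[OF \<phi> _ _ mom] by blast
    moreover have "contour_integral (circlepath 0 1) (\<lambda>u. \<phi> u / u) / (2 * of_real pi * \<i>) = mat 1 $ i $ j"
    proof -
      have "(\<lambda>u. \<phi> u / u) = (\<lambda>u. \<phi> u * u powi (- 0 - 1))"
        by (simp add: fun_eq_iff field_simps)
      then show ?thesis using lc[of 0] unfolding lcoeff_def by simp
    qed
    ultimately show ?thesis using circ by auto
  qed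
  note ex = this
  define h where "h i j = (SOME h. h analytic_on cball 0 1 \<and> (\<forall>w\<in>sphere 0 1. h w = cnj (P w $ j $ i)) \<and> h 0 = mat 1 $ i $ j)" for i j
  have h: "h i j analytic_on cball 0 1 \<and> (\<forall>w\<in>sphere 0 1. h i j w = cnj (P w $ j $ i)) \<and> h i j 0 = mat 1 $ i $ j" for i j
    unfolding h_def by (rule someI_ex[OF ex])
  show ?thesis
    by (rule exI[of _ "\<lambda>w. \<chi> i j. h i j w"])
       (use h in \<open>simp add: mat_analytic_on_def vec_eq_iff\<close>)
qed

text \<open>The entries i j and j i are both analytic on the disc and conjugate to each other on its
  boundary.\<close>

lemma hermitian_on_circle_constant:
  fixes Q :: "complex \<Rightarrow> complex^'n^'n"
  assumes Q: "mat_analytic_on Q (cball 0 1)" and herm: "\<And>w. norm w = 1 \<Longrightarrow> hermitian_mat (Q w)"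
    and w: "norm w \<le> 1"
  shows "Q w = Q 0"
proof -
  have "Q w $ i $ j = Q 0 $ i $ j" for i j
  proof (rule analytic_disc_conj_constant[of "\<lambda>w. Q w $ j $ i"])
    show "Q w $ i $ j = cnj (Q w $ j $ i)" if "norm w = 1" for w
      using hermitian_matD[OF herm[OF that]] by simp
  qed (use Q w in \<open>auto simp: mat_analytic_on_def\<close>)
  then show ?thesis by (simp add: vec_eq_iff)
qed

text \<open>By the convolution rule the n-th equation of the half-line system computes the n-th
  Laurent coefficient of P = X F. Since F is Hermitian on the circle, the adjoint of P there is F
  times the adjoint of X.\<close>

lemma Wiener_Hopf_pair_exists:
  fixes F :: "complex \<Rightarrow> complex^'n^'n"
  assumes F: "mat_analytic_on F (sphere 0 1)"
    and pos: "\<And>w. norm w = 1 \<Longrightarrow> psd (F w) \<and> invertible (F w)"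
  shows "\<exists>X K. mat_analytic_on X (cball 0 1) \<and> mat_analytic_on K (cball 0 1) \<and> K 0 = mat 1 \<and>
     (\<forall>w\<in>sphere 0 1. K w = F w ** cadjoint (X w))"
proof -
  obtain a b where ab: "0 < a" "a < 1" "1 < b" and hol: "\<And>i j. (\<lambda>w. F w $ i $ j) holomorphic_on annulus a b"
    using mat_analytic_on_circle_imp_annulus[OF F] by blast
  obtain s B x where s: "1 < s" and x: "\<And>k. norm (x k) \<le> B / s ^ k"
    and eq: "\<And>n::nat. (\<lambda>k. x k ** mat_lcoeff F (int n - int k)) sums (if n = 0 then mat 1 else 0)"
    using Toeplitz_system_solution[OF hol _ ab(2,3) pos] ab(1) by (auto simp: less_imp_le)
  have xij: "norm (x k $ i $ j) \<le> B / s ^ k" for k i j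
    using x[of k] Finite_Cartesian_Product.norm_nth_le[of "x k" i] Finite_Cartesian_Product.norm_nth_le[of "x k $ i" j]
    by linarith
  define X where "X w = (\<chi> i j. \<Sum>k. x k $ i $ j * w ^ k)" for w
  have Xhol: "(\<lambda>w. X w $ i $ j) holomorphic_on ball 0 s" for i j
    unfolding X_def vec_lambda_beta using power_series_geometric_bound(1)[OF xij] s by simp
  then have X: "mat_analytic_on X (cball 0 1)"
    unfolding mat_analytic_on_def analytic_on_holomorphic using s by (auto intro!: exI[of _ "ball 0 s"])
  define P where "P w = X w ** F w" for w
  have Phol: "(\<lambda>w. P w $ i $ j) holomorphic_on annulus a (min b s)" for i j
    unfolding P_def matrix_matrix_mult_def vec_lambda_beta
    by (intro holomorphic_intros holomorphic_on_subset[OF Xhol] holomorphic_on_subset[OF hol]) (auto simp: annulus_def)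
  have contF: "continuous_on (sphere 0 1) (\<lambda>w. F w $ i $ j)" for i j
    by (rule continuous_on_subset[OF holomorphic_on_imp_continuous_on[OF hol]]) (use ab in \<open>auto simp: annulus_def\<close>)
  have contX: "continuous_on (sphere 0 1) (\<lambda>w. X w $ i $ j)" for i j
    by (rule continuous_on_subset[OF holomorphic_on_imp_continuous_on[OF Xhol]]) (use s in auto)
  have "mat_lcoeff P (int n) = (if n = 0 then mat 1 else 0)" for n
  proof -
    have "mat_lcoeff P (int n) $ i $ j = (if n = 0 then mat 1 else 0 :: complex^'n^'n) $ i $ j" for i j
    proof -
      have "(\<lambda>k. x k $ i $ l * lcoeff (\<lambda>w. F w $ l $ j) (int n - int k)) sums lcoeff (\<lambda>w. X w $ i $ l * F w $ l $ j) (int n)" for l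
        unfolding X_def vec_lambda_beta by (rule lcoeff_power_series_mult[OF xij s contF])
      then have "(\<lambda>k. \<Sum>l\<in>UNIV. x k $ i $ l * lcoeff (\<lambda>w. F w $ l $ j) (int n - int k)) sums
          (\<Sum>l\<in>UNIV. lcoeff (\<lambda>w. X w $ i $ l * F w $ l $ j) (int n))"
        by (intro sums_sum)
      also have "(\<lambda>k. \<Sum>l\<in>UNIV. x k $ i $ l * lcoeff (\<lambda>w. F w $ l $ j) (int n - int k)) =
          (\<lambda>k. (x k ** mat_lcoeff F (int n - int k)) $ i $ j)"
        by (simp add: matrix_matrix_mult_def mat_lcoeff_def)
      also have "(\<Sum>l\<in>UNIV. lcoeff (\<lambda>w. X w $ i $ l * F w $ l $ j) (int n)) = mat_lcoeff P (int n) $ i $ j"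
        unfolding mat_lcoeff_def P_def matrix_matrix_mult_def vec_lambda_beta
        by (intro lcoeff_sum[symmetric] continuous_intros contF contX)
      finally have 1: "(\<lambda>k. (x k ** mat_lcoeff F (int n - int k)) $ i $ j) sums mat_lcoeff P (int n) $ i $ j" .
      have "(\<lambda>k. (x k ** mat_lcoeff F (int n - int k)) $ i $ j) sums (if n = 0 then mat 1 else 0 :: complex^'n^'n) $ i $ j"
        by (intro bounded_linear.sums[OF bounded_linear_vec_nth] eq)
      with 1 show ?thesis by (rule sums_unique2)
    qed
    then show ?thesis by (simp add: vec_eq_iff)
  qed
  then obtain K where K: "mat_analytic_on K (cball 0 1)" "\<And>w. w \<in> sphere 0 1 \<Longrightarrow> K w = cadjoint (P w)" "K 0 = mat 1"
    using adjoint_extension_to_disc[OF Phol ab(1,2)] ab s by auto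
  moreover have "cadjoint (P w) = F w ** cadjoint (X w)" if "w \<in> sphere 0 1" for w
    using pos[of w] that by (simp add: P_def cadjoint_mult psd_def hermitian_mat_def)
  ultimately show ?thesis using X by (intro exI[of _ X] exI[of _ K]) auto
qed

theorem positive_definite_factorization:
  fixes F :: "complex \<Rightarrow> complex^'n^'n"
  assumes F: "mat_analytic_on F (sphere 0 1)"
    and pos: "\<And>w. norm w = 1 \<Longrightarrow> psd (F w) \<and> invertible (F w)"
  shows "\<exists>S :: complex \<Rightarrow> complex^'n^'n. mat_analytic_on S (cball 0 1) \<and> (\<forall>w\<in>cball 0 1. invertible (S w)) \<and>
     (\<forall>w\<in>sphere 0 1. F w = S w ** cadjoint (S w))"
proof -
  obtain X K where X: "mat_analytic_on X (cball 0 1)" and K: "mat_analytic_on K (cball 0 1)" "K 0 = mat 1"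
    and KF: "\<And>w. norm w = 1 \<Longrightarrow> K w = F w ** cadjoint (X w)"
    using Wiener_Hopf_pair_exists[OF assms] by auto
  define A where "A = X 1 ** K 1"
  have psdXK: "psd (X w ** K w)" if "norm w = 1" for w
    using psd_congruence[of "F w" "cadjoint (X w)"] pos[OF that] KF[OF that] by (simp add: matrix_mul_assoc)
  have const: "X w ** K w = X 0 ** K 0" if "norm w \<le> 1" for w
    by (rule hermitian_on_circle_constant[OF mat_analytic_on_mult[OF X K(1)] _ that])
       (use psdXK in \<open>simp add: psd_def\<close>)
  have XK: "X w ** K w = A" if "norm w \<le> 1" for w
    using const[OF that] const[of 1] by (simp add: A_def)
  have A: "psd A" unfolding A_def by (rule psdXK) simp
  \<comment> \<open>A kernel vector of A annihilates the form of F at each point of the circle, so K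
    w v = 0 there. Analyticity carries this to the centre, where K is the identity.\<close>
  have "v = 0" if v: "A *v v = 0" for v
  proof -
    have "K w *v v = 0" if w: "norm w = 1" for w
    proof -
      have "A = cadjoint (cadjoint (X w)) ** F w ** cadjoint (X w)"
        using XK[of w] w KF[OF w] by (simp add: matrix_mul_assoc)
      then have "hform (F w) (cadjoint (X w) *v v) = hform A v" by (simp only: hform_congruence)
      also have "\<dots> = 0" using v by (simp add: hform_eq_sum)
      finally have "F w *v (cadjoint (X w) *v v) = 0"
        using pos[OF w] psd_hform_zero by blast
      then show ?thesis by (simp add: KF[OF w] matrix_vector_mul_assoc)
    qed
    note Kv = this
    \<comment> \<open>On the circle the components of K w v are the conjugate of the zero function,
      which makes them constant on the disc.\<close>
    have "(K 0 *v v) $ i = (K 1 *v v) $ i" for i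
    proof (rule sym, rule analytic_disc_conj_constant[of "\<lambda>w. 0" "\<lambda>w. (K w *v v) $ i"])
      show "(\<lambda>w. (K w *v v) $ i) analytic_on cball 0 1"
        using K(1) unfolding matrix_vector_mult_def mat_analytic_on_def by (auto intro!: analytic_intros)
    qed (auto simp: Kv)
    then have "K 0 *v v = 0" using Kv[of 1] by (simp add: vec_eq_iff)
    then show "v = 0" by (simp add: K(2))
  qed
  then have invA: "invertible A"
    by (meson invertible_left_inverse matrix_left_invertible_ker)
  have invK: "invertible (K w)" if "norm w \<le> 1" for w
    using invA XK[OF that] by (metis det_mul invertible_det_nz mult_zero_right)
  obtain B :: "complex^'n^'n" where B: "A = B ** cadjoint B" using psd_factorization[OF A] by blast
  have invB: "invertible (cadjoint B)"
    using invA B by (metis det_mul invertible_det_nz mult_zero_right)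
  then obtain C where C: "cadjoint B ** C = mat 1" "C ** cadjoint B = mat 1"
    unfolding invertible_def by blast
  have CA: "C ** cadjoint C ** A = mat 1"
  proof -
    have "cadjoint C ** B = mat 1" using arg_cong[OF C(1), of cadjoint] by (simp add: cadjoint_mult)
    then have "C ** cadjoint C ** (B ** cadjoint B) = C ** cadjoint B"
      by (metis matrix_mul_assoc matrix_mul_lid)
    then show ?thesis using B C by simp
  qed
  show ?thesis
  proof (intro exI[of _ "\<lambda>w. K w ** C"] conjI ballI)
    show "mat_analytic_on (\<lambda>w. K w ** C) (cball 0 1)"
      by (intro mat_analytic_on_mult mat_analytic_on_const K)
    show "invertible (K w ** C)" if "w \<in> cball 0 1" for w
    proof (rule invertible_mult)
      show "invertible C" using C unfolding invertible_def by blast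
    qed (use invK that in simp)
    fix w :: complex assume "w \<in> sphere 0 1"
    then have w: "norm w = 1" by simp
    have Kadj: "cadjoint (K w) = X w ** F w"
      using pos[OF w] by (simp add: KF[OF w] cadjoint_mult psd_def hermitian_mat_def)
    \<comment> \<open>The product of C and its adjoint is the inverse of A, so X K = A exhibits a
      left inverse of K w. For square matrices it is also a right inverse, and multiplying it by F w
      gives the factorization.\<close>
    have "(C ** cadjoint C ** X w) ** K w = mat 1"
      using CA XK[of w] w by (simp add: matrix_mul_assoc[symmetric])
    then have "K w ** (C ** cadjoint C ** X w) = mat 1"
      using matrix_left_right_inverse by blast
    then have "(K w ** C) ** cadjoint (K w ** C) = F w"
      by (simp add: cadjoint_mult Kadj matrix_mul_assoc)
    then show "F w = (K w ** C) ** cadjoint (K w ** C)" by simp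
  qed
qed

section \<open>Removal of zeros on the circle\<close>

lemma at_within_circle_nontrivial:
  assumes "norm p = 1"
  shows "at p within sphere (0::complex) 1 \<noteq> bot" "p islimpt sphere (0::complex) 1"
proof -
  have "sphere (0::complex) 1 \<noteq> {x}" for x
  proof
    assume "sphere 0 1 = {x}"
    then have "1 \<in> {x}" "- 1 \<in> {x}" by (metis mem_sphere_0 norm_one norm_minus_cancel)+
    then have "(1::complex) = - 1" by simp
    then show False by simp
  qed
  then show "p islimpt sphere (0::complex) 1"
    using assms by (intro connected_imp_perfect connected_sphere) auto
  then show "at p within sphere (0::complex) 1 \<noteq> bot"
    by (simp add: trivial_limit_within)
qed

text \<open>Up to the unit -1 / (w p), the conjugate of w - p on the circle is w - p itself.
  Dividing by the conjugate factor is therefore an analytic operation.\<close>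

lemma cnj_diff_on_circle:
  assumes "norm w = 1" "norm p = 1"
  shows "cnj (w - p) * (w * p) = - (w - p)"
proof -
  have "cnj w * w = 1" "cnj p * p = 1"
    using assms by (simp_all add: mult.commute flip: complex_norm_square)
  moreover have "cnj (w - p) * (w * p) = (cnj w * w) * p - (cnj p * p) * w"
    by (simp add: algebra_simps)
  ultimately show ?thesis by simp
qed

text \<open>Along the circle f is real with a minimum at p, so its tangential derivative p i f'(p)
  vanishes: the real part by minimality, the imaginary part because f is real.\<close>

lemma deriv_zero_of_nonneg_on_circle:
  assumes f: "f analytic_on sphere 0 1" and p: "norm p = 1"
    and im: "\<And>w. norm w = 1 \<Longrightarrow> Im (f w) = 0" and re: "\<And>w. norm w = 1 \<Longrightarrow> 0 \<le> Re (f w)" and fp: "f p = 0"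
  shows "deriv f p = 0"
proof -
  define \<gamma> where "\<gamma> t = p * exp (\<i> * of_real t)" for t :: real
  have norm\<gamma>: "norm (\<gamma> t) = 1" for t by (simp add: \<gamma>_def norm_mult p)
  have \<gamma>0: "\<gamma> 0 = p" by (simp add: \<gamma>_def)
  have "((\<lambda>z. p * exp (\<i> * z)) has_field_derivative p * \<i>) (at (of_real 0))"
    by (auto intro!: derivative_eq_intros)
  from has_vector_derivative_real_field[OF this]
  have "(\<gamma> has_vector_derivative p * \<i>) (at 0)" unfolding \<gamma>_def .
  moreover have "(f has_field_derivative deriv f p) (at (\<gamma> 0))"
    unfolding \<gamma>0 using analytic_on_imp_differentiable_at[OF f] p
    by (simp add: DERIV_deriv_iff_field_differentiable)
  ultimately have d: "((f \<circ> \<gamma>) has_vector_derivative p * \<i> * deriv f p) (at 0)"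
    by (rule field_vector_diff_chain_at)
  have "((\<lambda>t. Re ((f \<circ> \<gamma>) t)) has_vector_derivative Re (p * \<i> * deriv f p)) (at 0)"
    by (rule bounded_linear.has_vector_derivative[OF bounded_linear_Re d])
  then have "((\<lambda>t. Re ((f \<circ> \<gamma>) t)) has_real_derivative Re (p * \<i> * deriv f p)) (at 0)"
    by (simp add: has_real_derivative_iff_has_vector_derivative)
  then have "Re (p * \<i> * deriv f p) = 0"
    by (rule DERIV_local_min[of _ _ _ 1]) (auto simp: \<gamma>0 fp re norm\<gamma>)
  moreover have "Im (p * \<i> * deriv f p) = 0"
  proof (rule vector_derivative_unique_at)
    show "((\<lambda>t. Im ((f \<circ> \<gamma>) t)) has_vector_derivative Im (p * \<i> * deriv f p)) (at 0)"
      by (rule bounded_linear.has_vector_derivative[OF bounded_linear_Im d])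
    show "((\<lambda>t. Im ((f \<circ> \<gamma>) t)) has_vector_derivative 0) (at 0)"
      by (simp add: im norm\<gamma>)
  qed
  ultimately have "p * \<i> * deriv f p = 0" by (simp add: complex_eq_iff)
  then show ?thesis using p by auto
qed

definition dquot :: "complex \<Rightarrow> (complex \<Rightarrow> complex) \<Rightarrow> complex \<Rightarrow> complex" where
  "dquot p f w = (if w = p then deriv f p else f w / (w - p))"

lemma dquot_analytic:
  assumes "f analytic_on S" "f p = 0"
  shows "dquot p f analytic_on S"
proof (rule pole_theorem_analytic_0[OF assms(1)])
  show "\<exists>d>0. \<forall>w\<in>ball z d - {p}. f w = (w - p) * dquot p f w" for z
    by (rule exI[of _ 1]) (auto simp: dquot_def)
qed (use assms in \<open>auto simp: dquot_def\<close>)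

definition dmat :: "('n \<Rightarrow> complex) \<Rightarrow> complex^'n^'n" where
  "dmat d = (\<chi> i j. if i = j then d i else 0)"

lemma dmat_mult_left: "(dmat d ** A) $ i $ j = d i * A $ i $ j"
  by (simp add: dmat_def matrix_matrix_mult_def if_distrib[of "\<lambda>x. x * _"] cong: if_cong)

lemma dmat_mult_cadjoint_right: "(A ** cadjoint (dmat d)) $ i $ j = A $ i $ j * cnj (d j)"
  by (simp add: dmat_def matrix_matrix_mult_def if_distrib[of "\<lambda>x. _ * x"] if_distrib[of cnj] cong: if_cong)

lemma det_dmat: "det (dmat d) = (\<Prod>i\<in>UNIV. d i)"
  using det_diagonal[of "dmat d"] by (simp add: dmat_def)

text \<open>The change of basis that sends the k-th unit vector to v.\<close>

lemma invertible_column_replacement: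
  fixes v :: "complex^'n"
  assumes "v $ k \<noteq> 0"
  shows "invertible (\<chi> i j. if j = k then v $ i else if i = j then 1 else 0)" (is "invertible ?V")
proof -
  have "x = 0" if x: "?V *v x = 0" for x
  proof -
    have "(\<Sum>j\<in>UNIV. (if j = k then v $ i else if i = j then 1 else 0) * x $ j) = v $ i * x $ k + (if i = k then 0 else x $ i)" for i
    proof -
      have "(\<Sum>j\<in>UNIV. (if j = k then v $ i else if i = j then 1 else 0) * x $ j)
        = (\<Sum>j\<in>UNIV. (if j = k then v $ i * x $ j else 0) + (if j = i then (if i = k then 0 else x $ j) else 0))"
        by (rule sum.cong) auto
      then show ?thesis by (simp add: sum.distrib)
    qed
    then have eq: "v $ i * x $ k + (if i = k then 0 else x $ i) = 0" for i
      using x by (simp add: matrix_vector_mult_def vec_eq_iff)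
    have "x $ k = 0" using eq[of k] assms by simp
    then have "x $ i = 0" for i using eq[of i] by (cases "i = k") auto
    then show ?thesis by (simp add: vec_eq_iff)
  qed
  then show ?thesis by (meson invertible_left_inverse matrix_left_invertible_ker)
qed

lemma zero_removal_diagonal:
  fixes M :: "complex \<Rightarrow> complex^'n^'n"
  assumes M: "mat_analytic_on M (sphere 0 1)" and psd: "\<And>w. norm w = 1 \<Longrightarrow> psd (M w)"
    and p: "norm p = 1" and zero: "M p $ k $ k = 0"
  shows "\<exists>F'. mat_analytic_on F' (sphere 0 1) \<and> (\<forall>w\<in>sphere 0 1. psd (F' w)) \<and>
    (\<forall>w\<in>sphere 0 1. M w = dmat (\<lambda>i. if i = k then w - p else 1) ** F' w ** cadjoint (dmat (\<lambda>i. if i = k then w - p else 1)))"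
proof -
  define m where "m i j w = M w $ i $ j" for i j w
  have m: "m i j analytic_on sphere 0 1" for i j
    using M unfolding mat_analytic_on_def m_def[abs_def] by blast
  have mp: "m i k p = 0" "m k i p = 0" for i
    using psd_diagonal_zero[OF psd[OF p] zero] by (auto simp: m_def)
  have dz: "dquot p (m k k) p = 0"
  proof -
    have "deriv (m k k) p = 0"
    proof (rule deriv_zero_of_nonneg_on_circle[OF m p])
      show "Im (m k k w) = 0" "0 \<le> Re (m k k w)" if "norm w = 1" for w
        using psd_diagonal[OF psd[OF that], of k] by (auto simp: m_def complex_is_Real_iff)
    qed (simp add: mp)
    then show ?thesis by (simp add: dquot_def)
  qed
  \<comment> \<open>Away from p these are the entries of M divided by w - p in row k and by its
    conjugate in column k, with 1 / cnj (w - p) written as -(w p) / (w - p) to keep them analytic.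
    The corner entry receives both divisions.\<close>
  define F' :: "complex \<Rightarrow> complex^'n^'n" where "F' w = (\<chi> i j.
      if i = k then (if j = k then dquot p (dquot p (m k k)) w * (- (w * p)) else dquot p (m k j) w)
      else (if j = k then dquot p (m i k) w * (- (w * p)) else m i j w))" for w
  have an: "mat_analytic_on F' (sphere 0 1)"
    unfolding mat_analytic_on_def
  proof (intro allI)
    fix i j
    have "(\<lambda>w. F' w $ i $ j) = (if i = k then (if j = k then (\<lambda>w. dquot p (dquot p (m k k)) w * (- (w * p))) else dquot p (m k j))
      else (if j = k then (\<lambda>w. dquot p (m i k) w * (- (w * p))) else m i j))"
      by (simp add: F'_def fun_eq_iff)
    moreover have "dquot p (dquot p (m k k)) analytic_on sphere 0 1"
      by (intro dquot_analytic m mp dz)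
    ultimately show "(\<lambda>w. F' w $ i $ j) analytic_on sphere 0 1"
      by (auto intro!: analytic_intros dquot_analytic m mp)
  qed
  have inv: "- (w * p) / (w - p) = inverse (cnj (w - p))" if "norm w = 1" "w \<noteq> p" for w
  proof -
    have "cnj (w - p) \<noteq> 0" "w - p \<noteq> 0" using that by auto
    moreover have "- (w * p) * cnj (w - p) = w - p"
      using cnj_diff_on_circle[OF that(1) p] by (metis minus_minus mult.commute mult_minus_left)
    ultimately have "cnj (w - p) * (- (w * p) / (w - p)) = 1"
      by (metis divide_self mult.commute times_divide_eq_left)
    then show ?thesis by (metis inverse_unique)
  qed
  let ?d = "\<lambda>w i. if i = k then w - p else 1"
  have eq: "F' w = dmat (\<lambda>i. inverse (?d w i)) ** M w ** cadjoint (dmat (\<lambda>i. inverse (?d w i)))"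
    if w: "norm w = 1" "w \<noteq> p" for w
  proof -
    have "F' w $ i $ j = inverse (?d w i) * M w $ i $ j * cnj (inverse (?d w j))" for i j
    proof -
      have *: "x / (w - p) * (- (w * p)) = x * inverse (cnj (w - p))" for x
        using inv[OF w] by (metis times_divide_eq_left times_divide_eq_right)
      show ?thesis
      proof (cases "j = k")
        case True
        have "F' w $ i $ j = (inverse (?d w i) * M w $ i $ j) / (w - p) * (- (w * p))"
          using w(2) True unfolding F'_def by (simp add: dquot_def m_def divide_inverse mult_ac)
        then show ?thesis unfolding * using True by simp
      next
        case False
        then show ?thesis
          using w(2) unfolding F'_def by (simp add: dquot_def m_def divide_inverse mult_ac)
      qed
    qed
    then show ?thesis by (simp add: vec_eq_iff dmat_mult_cadjoint_right dmat_mult_left)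
  qed
  have psd': "psd (F' w)" if w: "norm w = 1" for w
  proof (cases "w = p")
    case False
    show ?thesis
      using psd_congruence[OF psd[OF w], of "cadjoint (dmat (\<lambda>i. inverse (?d w i)))"] eq[OF w False] by simp
  next
    case True
    \<comment> \<open>No congruence is available at p itself, so semidefiniteness is obtained as a
      limit along the circle.\<close>
    have "(F' \<longlongrightarrow> F' p) (at p within sphere 0 1)"
      using mat_analytic_on_imp_continuous_on[OF an] p unfolding continuous_on_def by simp
    moreover have "\<forall>\<^sub>F u in at p within sphere 0 1. psd (F' u)"
      unfolding eventually_at_filter
    proof (intro always_eventually allI impI)
      fix u assume "u \<noteq> p" "u \<in> sphere 0 1"
      then show "psd (F' u)"
        using psd_congruence[OF psd[of u], of "cadjoint (dmat (\<lambda>i. inverse (?d u i)))"] eq[of u] by simp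
    qed
    ultimately show ?thesis using True psd_limit at_within_circle_nontrivial(1)[OF p] by blast
  qed
  have "M w = dmat (?d w) ** F' w ** cadjoint (dmat (?d w))" if w: "norm w = 1" for w
  proof -
    have "M w $ i $ j = ?d w i * F' w $ i $ j * cnj (?d w j)" for i j
    proof (cases "w = p")
      case True
      then show ?thesis using mp by (auto simp: F'_def m_def)
    next
      case False
      have "F' w $ i $ j = inverse (?d w i) * M w $ i $ j * cnj (inverse (?d w j))"
        by (simp add: eq[OF w False] dmat_mult_cadjoint_right dmat_mult_left)
      moreover have "?d w i \<noteq> 0" "?d w j \<noteq> 0" using False by auto
      ultimately show ?thesis by (simp add: field_simps del: complex_cnj_diff)
    qed
    then show ?thesis by (simp add: vec_eq_iff dmat_mult_cadjoint_right dmat_mult_left)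
  qed
  then show ?thesis using an psd' by (intro exI[of _ F']) auto
qed

text \<open>Congruence by V makes the k-th diagonal entry vanish at p. Undoing it gives P as an
  invertible constant times the diagonal factor, so det P is a nonzero multiple of w - p. The
  determinant identity, with \<kappa> = |det W|^2, is recorded to measure progress.\<close>

lemma zero_removal_step:
  fixes F :: "complex \<Rightarrow> complex^'n^'n"
  assumes F: "mat_analytic_on F (sphere 0 1)" and psd: "\<And>w. norm w = 1 \<Longrightarrow> psd (F w)"
    and p: "norm p = 1" and zero: "det (F p) = 0"
  shows "\<exists>(F' :: complex \<Rightarrow> complex^'n^'n) (P :: complex \<Rightarrow> complex^'n^'n) \<kappa>.
     mat_analytic_on F' (sphere 0 1) \<and> (\<forall>w. norm w = 1 \<longrightarrow> psd (F' w)) \<and>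
     mat_analytic_on P (cball 0 1) \<and> (\<forall>w. w \<noteq> p \<longrightarrow> invertible (P w)) \<and>
     (\<forall>w. norm w = 1 \<longrightarrow> F w = P w ** F' w ** cadjoint (P w)) \<and>
     \<kappa> \<noteq> 0 \<and> (\<forall>w. norm w = 1 \<longrightarrow> det (F w) = \<kappa> * ((w - p) * cnj (w - p)) * det (F' w))"
proof -
  obtain v where v: "F p *v v = 0" "v \<noteq> 0"
    using zero by (metis invertible_det_nz invertible_left_inverse matrix_left_invertible_ker)
  then obtain k where k: "v $ k \<noteq> 0" by (metis vec_eq_iff zero_index)
  define V where "V = (\<chi> i j. if j = k then v $ i else if i = j then 1 else 0)"
  have "invertible V" unfolding V_def by (rule invertible_column_replacement[of v k, OF k])
  then obtain W where W: "V ** W = mat 1" "W ** V = mat 1" unfolding invertible_def by blast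
  define M where "M w = cadjoint V ** F w ** V" for w
  have Mk: "M p $ k $ k = 0"
  proof -
    have "V *v axis k 1 = v" by (simp add: vec_eq_iff matrix_vector_axis V_def)
    then have "M p *v axis k 1 = 0" using v(1) by (simp add: M_def flip: matrix_vector_mul_assoc)
    then show ?thesis using matrix_vector_axis[of "M p" k k] by simp
  qed
  have M: "mat_analytic_on M (sphere 0 1)"
    unfolding M_def by (intro mat_analytic_on_mult mat_analytic_on_const F)
  define \<Delta> :: "complex \<Rightarrow> complex^'n^'n" where "\<Delta> w = dmat (\<lambda>i. if i = k then w - p else 1)" for w
  have psdM: "psd (M w)" if "norm w = 1" for w
    unfolding M_def by (rule psd_congruence[OF psd[OF that]])
  obtain F' where F1: "mat_analytic_on F' (sphere 0 1)" "\<forall>w\<in>sphere 0 1. psd (F' w)"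
      "\<forall>w\<in>sphere 0 1. M w = \<Delta> w ** F' w ** cadjoint (\<Delta> w)"
    using zero_removal_diagonal[OF M psdM p Mk] unfolding \<Delta>_def by blast
  then have F': "mat_analytic_on F' (sphere 0 1)" "\<And>w. norm w = 1 \<Longrightarrow> psd (F' w)"
    and MF': "\<And>w. norm w = 1 \<Longrightarrow> M w = \<Delta> w ** F' w ** cadjoint (\<Delta> w)"
    by auto
  define P where "P w = cadjoint W ** \<Delta> w" for w
  have det\<Delta>: "det (\<Delta> w) = w - p" for w
    unfolding \<Delta>_def det_dmat by simp
  have detW: "det W \<noteq> 0" using W by (metis det_I det_mul mult_zero_right zero_neq_one)
  have detP: "det (P w) = cnj (det W) * (w - p)" for w
    by (simp add: P_def det_mul det\<Delta> det_cadjoint)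
  have FM: "F w = cadjoint W ** M w ** W" for w
  proof -
    have "cadjoint W ** cadjoint V = mat 1" using arg_cong[OF W(1), of cadjoint] by (simp add: cadjoint_mult)
    then have "cadjoint W ** (cadjoint V ** F w ** V) ** W = F w ** (V ** W)"
      by (metis matrix_mul_assoc matrix_mul_lid)
    then show ?thesis using W by (simp add: M_def)
  qed
  have FP: "F w = P w ** F' w ** cadjoint (P w)" if "norm w = 1" for w
    unfolding FM MF'[OF that] P_def by (simp add: cadjoint_mult matrix_mul_assoc)
  show ?thesis
  proof (intro exI conjI allI impI)
    show "mat_analytic_on F' (sphere 0 1)" by fact
    show "psd (F' w)" if "norm w = 1" for w by (rule F'(2)[OF that])
    show "mat_analytic_on P (cball 0 1)"
      unfolding P_def
    proof (intro mat_analytic_on_mult mat_analytic_on_const)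
      show "mat_analytic_on \<Delta> (cball 0 1)"
        unfolding mat_analytic_on_def
      proof (intro allI)
        fix i j
        have "(\<lambda>w. \<Delta> w $ i $ j) = (if i = j then if i = k then (\<lambda>w. w - p) else (\<lambda>w. 1) else (\<lambda>w. 0))"
          by (simp add: \<Delta>_def dmat_def fun_eq_iff)
        then show "(\<lambda>w. \<Delta> w $ i $ j) analytic_on cball 0 1"
          by (auto intro!: analytic_intros)
      qed
    qed
    show "invertible (P w)" if "w \<noteq> p" for w
      using that detW by (simp add: invertible_det_nz detP)
    show "F w = P w ** F' w ** cadjoint (P w)" if "norm w = 1" for w by (rule FP[OF that])
    show "cnj (det W) * det W \<noteq> 0" using detW by simp
    show "det (F w) = cnj (det W) * det W * ((w - p) * cnj (w - p)) * det (F' w)" if "norm w = 1" for w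
      by (simp add: FP[OF that] det_mul det_cadjoint detP)
  qed
qed

section \<open>Induction on the zeros of the determinant\<close>

lemma mat_analytic_on_det:
  fixes F :: "complex \<Rightarrow> complex^'n^'n"
  assumes "mat_analytic_on F S"
  shows "(\<lambda>w. det (F w)) analytic_on S"
  using assms unfolding det_def mat_analytic_on_def by (auto intro!: analytic_intros)

text \<open>The order of the zero is expressed by a limit along the circle because the determinant
  identity of the removal step involves a conjugate and holds only there. The finite set Z rules out
  that the determinant vanishes identically near p.\<close>

lemma det_order_exists:
  fixes F :: "complex \<Rightarrow> complex^'n^'n"
  assumes F: "mat_analytic_on F (sphere 0 1)" and p: "norm p = 1"
    and Z: "finite Z" "\<And>w. norm w = 1 \<Longrightarrow> w \<notin> Z \<Longrightarrow> det (F w) \<noteq> 0"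
  shows "\<exists>n L. L \<noteq> 0 \<and> ((\<lambda>w. det (F w) / (w - p) ^ n) \<longlongrightarrow> L) (at p within sphere 0 1)"
proof -
  define f where "f w = det (F w)" for w
  have f: "f analytic_on sphere 0 1" unfolding f_def by (rule mat_analytic_on_det[OF F])
  show ?thesis
  proof (cases "f p = 0")
    case False
    have "continuous_on (sphere 0 1) f"
      by (intro holomorphic_on_imp_continuous_on analytic_imp_holomorphic f)
    then have "(f \<longlongrightarrow> f p) (at p within sphere 0 1)" using p by (simp add: continuous_on_def)
    then show ?thesis using False by (intro exI[of _ 0] exI[of _ "f p"]) (simp flip: f_def)
  next
    case True
    obtain e where e: "e > 0" "f holomorphic_on ball p e"
      using bspec[OF f[unfolded analytic_on_def], of p] p by auto
    have "\<not> f constant_on ball p e"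
    proof
      assume "f constant_on ball p e"
      then have c: "f w = 0" if "w \<in> ball p e" for w
        using that True e(1) unfolding constant_on_def by (metis centre_in_ball)
      \<comment> \<open>The circle accumulates at p, so the ball contains points of the circle
        outside Z.\<close>
      have "infinite (sphere 0 1 \<inter> ball p e)"
        using at_within_circle_nontrivial(2)[OF p] e(1) unfolding islimpt_eq_infinite_ball by blast
      then obtain w where "w \<in> sphere 0 1 \<inter> ball p e" "w \<notin> Z"
        using Z(1) by (meson finite_subset subsetI)
      then show False using Z(2)[of w] c[of w] by (simp add: f_def)
    qed
    from holomorphic_factor_zero_nonconstant[OF e(2) open_ball connected_ball _ True this]
    obtain g r n where r: "0 < r" and g: "g holomorphic_on ball p r"
      and eq: "\<And>w. w \<in> ball p r \<Longrightarrow> f w = (w - p) ^ n * g w" and nz: "\<And>w. w \<in> ball p r \<Longrightarrow> g w \<noteq> 0"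
      using e(1) by (metis centre_in_ball)
    have "isCont g p"
      using holomorphic_on_imp_continuous_on[OF g] r by (simp add: continuous_on_interior)
    then have "(g \<longlongrightarrow> g p) (at p within sphere 0 1)"
      using continuous_at_imp_continuous_at_within[of p g] by (auto simp: continuous_within)
    moreover have "\<forall>\<^sub>F w in at p within sphere 0 1. g w = f w / (w - p) ^ n"
      unfolding eventually_at
      by (intro exI[of _ r] conjI r ballI impI) (use eq in \<open>auto simp: dist_commute\<close>)
    ultimately have "((\<lambda>w. f w / (w - p) ^ n) \<longlongrightarrow> g p) (at p within sphere 0 1)"
      by (rule Lim_transform_eventually)
    then show ?thesis using nz[of p] r by (auto simp: f_def)
  qed
qed

text \<open>Multiplying by -(w p) / \<kappa> turns the factor |w - p|^2 into (w - p)^2 on the circle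
  and keeps the limit nonzero; two powers then cancel.\<close>

lemma order_drops_by_two:
  fixes f f' :: "complex \<Rightarrow> complex"
  assumes p: "norm p = 1" and \<kappa>: "\<kappa> \<noteq> 0"
    and eq: "\<And>w. norm w = 1 \<Longrightarrow> f w = \<kappa> * ((w - p) * cnj (w - p)) * f' w"
    and cont: "continuous_on (sphere 0 1) f'" and L: "L \<noteq> 0"
    and lim: "((\<lambda>w. f w / (w - p) ^ n) \<longlongrightarrow> L) (at p within sphere 0 1)"
  shows "2 \<le> n \<and> (\<exists>L'. L' \<noteq> 0 \<and> ((\<lambda>w. f' w / (w - p) ^ (n - 2)) \<longlongrightarrow> L') (at p within sphere 0 1))"
proof -
  let ?A = "at p within sphere (0::complex) 1"
  have idl: "((\<lambda>w. w) \<longlongrightarrow> p) ?A" by (rule tendsto_ident_at)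
  have f': "(f' \<longlongrightarrow> f' p) ?A" using cont p by (simp add: continuous_on_def)
  have p0: "p \<noteq> 0" using p by auto
  define L' where "L' = - (p * p / \<kappa>) * L"
  have L': "L' \<noteq> 0" using L \<kappa> p0 by (simp add: L'_def)
  have lim': "((\<lambda>w. - (w * p / \<kappa>) * (f w / (w - p) ^ n)) \<longlongrightarrow> L') ?A"
    unfolding L'_def by (intro tendsto_intros lim idl \<kappa>)
  have rel: "- (w * p / \<kappa>) * f w = (w - p)\<^sup>2 * f' w" if w: "norm w = 1" for w
  proof -
    have "- (w * p / \<kappa>) * f w = - (cnj (w - p) * (w * p)) * (w - p) * f' w"
      unfolding eq[OF w] using \<kappa> by (simp add: field_simps del: complex_cnj_diff)
    then show ?thesis by (simp only: cnj_diff_on_circle[OF w p]) (simp add: power2_eq_square)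
  qed
  have ev: "\<forall>\<^sub>F w in ?A. - (w * p / \<kappa>) * (f w / (w - p) ^ n) = (w - p)\<^sup>2 * f' w / (w - p) ^ n"
    unfolding eventually_at_filter
  proof (intro always_eventually allI impI)
    fix w assume "w \<in> sphere (0::complex) 1"
    then have "norm w = 1" by simp
    have "- (w * p / \<kappa>) * (f w / (w - p) ^ n) = (- (w * p / \<kappa>) * f w) / (w - p) ^ n"
      by (simp only: times_divide_eq_right)
    also have "\<dots> = (w - p)\<^sup>2 * f' w / (w - p) ^ n" by (simp only: rel[OF \<open>norm w = 1\<close>])
    finally show "- (w * p / \<kappa>) * (f w / (w - p) ^ n) = (w - p)\<^sup>2 * f' w / (w - p) ^ n" .
  qed
  have lim2: "((\<lambda>w. (w - p)\<^sup>2 * f' w / (w - p) ^ n) \<longlongrightarrow> L') ?A"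
    by (rule Lim_transform_eventually[OF lim' ev])
  \<comment> \<open>For n < 2 a positive power of w - p would remain and the limit would be
    0.\<close>
  have n2: "2 \<le> n"
  proof (rule ccontr)
    assume "\<not> 2 \<le> n"
    then have n: "n < 2" by simp
    have "((\<lambda>w. (w - p) ^ (2 - n) * f' w) \<longlongrightarrow> (p - p) ^ (2 - n) * f' p) ?A"
      by (intro tendsto_intros idl f')
    then have "((\<lambda>w. (w - p) ^ (2 - n) * f' w) \<longlongrightarrow> 0) ?A" using n by (simp add: power_0_left)
    moreover have "\<forall>\<^sub>F w in ?A. (w - p) ^ (2 - n) * f' w = (w - p)\<^sup>2 * f' w / (w - p) ^ n"
      unfolding eventually_at_filter using n by (intro always_eventually) (simp add: power_diff)
    ultimately have "((\<lambda>w. (w - p)\<^sup>2 * f' w / (w - p) ^ n) \<longlongrightarrow> 0) ?A"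
      by (rule Lim_transform_eventually)
    with lim2 L' show False using tendsto_unique at_within_circle_nontrivial(1)[OF p] by blast
  qed
  have "\<forall>\<^sub>F w in ?A. (w - p)\<^sup>2 * f' w / (w - p) ^ n = f' w / (w - p) ^ (n - 2)"
    unfolding eventually_at_filter using n2 by (intro always_eventually) (simp add: power_diff)
  from Lim_transform_eventually[OF lim2 this] show ?thesis using n2 L' by blast
qed

text \<open>The outer induction is on the set Z that contains the zeros of the determinant, the
  inner one on the order of the zero at p. The symbol is generalised in both, since every removal
  replaces F by F'; the factors P collect on the left of S.\<close>

theorem psd_circle_factorization:
  fixes F :: "complex \<Rightarrow> complex^'n^'n"
  assumes "finite Z" "mat_analytic_on F (sphere 0 1)" "\<And>w. norm w = 1 \<Longrightarrow> psd (F w)"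
    "\<And>w. norm w = 1 \<Longrightarrow> w \<notin> Z \<Longrightarrow> det (F w) \<noteq> 0"
  shows "\<exists>S :: complex \<Rightarrow> complex^'n^'n. mat_analytic_on S (cball 0 1) \<and> (\<forall>w\<in>ball 0 1. invertible (S w)) \<and>
     (\<forall>w\<in>sphere 0 1. F w = S w ** cadjoint (S w))"
  using assms
proof (induction Z arbitrary: F rule: finite_induct)
  case empty
  then have "\<exists>S :: complex \<Rightarrow> complex^'n^'n. mat_analytic_on S (cball 0 1) \<and> (\<forall>w\<in>cball 0 1. invertible (S w)) \<and>
     (\<forall>w\<in>sphere 0 1. F w = S w ** cadjoint (S w))"
    by (intro positive_definite_factorization) (auto simp: invertible_det_nz)
  then show ?case by (metis ball_subset_cball subsetD)
next
  case (insert p Z)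
  show ?case
  proof (cases "norm p = 1")
    case False
    show ?thesis
      by (rule insert.IH[OF insert.prems(1,2)]) (use False insert.prems(3) in auto)
  next
    case p: True
    have finZ: "finite (insert p Z)" using insert.hyps by simp
    obtain n L where "L \<noteq> 0" "((\<lambda>w. det (F w) / (w - p) ^ n) \<longlongrightarrow> L) (at p within sphere 0 1)"
      using det_order_exists[OF insert.prems(1) p finZ insert.prems(3)] by blast
    with insert.prems show ?thesis
    proof (induction n arbitrary: F L rule: less_induct)
      case (less n)
      show ?case
      proof (cases "det (F p) = 0")
        case False
        \<comment> \<open>The determinant no longer vanishes at p, so Z alone contains all
          zeros.\<close>
        show ?thesis
          by (rule insert.IH[OF less.prems(1,2)]) (use False less.prems(3) in auto)
      next
        case True
        obtain F' P :: "complex \<Rightarrow> complex^'n^'n" and \<kappa> where F': "mat_analytic_on F' (sphere 0 1)" "\<And>w. norm w = 1 \<Longrightarrow> psd (F' w)"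
          and P: "mat_analytic_on P (cball 0 1)" "\<And>w. w \<noteq> p \<Longrightarrow> invertible (P w)"
          and FP: "\<And>w. norm w = 1 \<Longrightarrow> F w = P w ** F' w ** cadjoint (P w)"
          and \<kappa>: "\<kappa> \<noteq> 0" and det: "\<And>w. norm w = 1 \<Longrightarrow> det (F w) = \<kappa> * ((w - p) * cnj (w - p)) * det (F' w)"
          using zero_removal_step[OF less.prems(1) _ p True] less.prems(2) by blast
        have cont: "continuous_on (sphere 0 1) (\<lambda>w. det (F' w))"
          by (intro holomorphic_on_imp_continuous_on analytic_imp_holomorphic mat_analytic_on_det F')
        obtain L' where n: "2 \<le> n" and L': "L' \<noteq> 0"
            "((\<lambda>w. det (F' w) / (w - p) ^ (n - 2)) \<longlongrightarrow> L') (at p within sphere 0 1)"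
          using order_drops_by_two[OF p \<kappa> det cont less.prems(4,5)] by blast
        have det': "det (F' w) \<noteq> 0" if "norm w = 1" "w \<notin> insert p Z" for w
          using less.prems(3)[OF that] det[OF that(1)] by auto
        have "n - 2 < n" using n by simp
        from less.IH[OF this F' det' L']
        obtain S :: "complex \<Rightarrow> complex^'n^'n" where S: "mat_analytic_on S (cball 0 1)" "\<And>w. w \<in> ball 0 1 \<Longrightarrow> invertible (S w)"
          "\<And>w. w \<in> sphere 0 1 \<Longrightarrow> F' w = S w ** cadjoint (S w)"
          by blast
        show ?thesis
        proof (intro exI[of _ "\<lambda>w. P w ** S w"] conjI ballI)
          show "mat_analytic_on (\<lambda>w. P w ** S w) (cball 0 1)" by (intro mat_analytic_on_mult P S)
          show "invertible (P w ** S w)" if "w \<in> ball 0 1" for w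
            using that p by (intro invertible_mult P S) auto
          show "F w = P w ** S w ** cadjoint (P w ** S w)" if "w \<in> sphere 0 1" for w
            using FP[of w] S(3)[OF that] that by (simp add: cadjoint_mult matrix_mul_assoc)
        qed
      qed
    qed
  qed
qed

section \<open>The inverse Joukowski map and the scalar Jacobi factor\<close>

text \<open>This is z - sqrt (z^2 - 1) with the root written as z * csqrt (1 - 1 / z^2), which meets
  the branch cut of \<open>csqrt\<close> only for z in [-1,1], and then rationalised so that the
  decay at infinity is visible.\<close>

definition inv_joukowski :: "complex \<Rightarrow> complex" where
  "inv_joukowski z = 1 / (z * (1 + csqrt (1 - 1 / z\<^sup>2)))"

abbreviation (input) slit_plane :: "complex set" where
  "slit_plane \<equiv> - (complex_of_real ` {-1..1})"

lemma open_slit_plane: "open slit_plane"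
  by (intro open_Compl compact_imp_closed compact_continuous_image continuous_intros) auto

lemma slit_plane_nonzero: "z \<in> slit_plane \<Longrightarrow> z \<noteq> 0"
  by (auto simp: image_iff)

lemma slit_plane_branch:
  assumes "z \<in> slit_plane"
  shows "1 - 1 / z\<^sup>2 \<notin> \<real>\<^sub>\<le>\<^sub>0"
proof
  assume "1 - 1 / z\<^sup>2 \<in> \<real>\<^sub>\<le>\<^sub>0"
  then obtain t where t: "t \<le> 0" "1 - 1 / z\<^sup>2 = complex_of_real t"
    by (auto simp: nonpos_Reals_def)
  define x where "x = 1 / sqrt (1 - t)"
  have x: "0 < x" "x \<le> 1" "x\<^sup>2 = 1 / (1 - t)" using t(1) by (auto simp: x_def power_divide)
  have "1 / z\<^sup>2 = complex_of_real (1 - t)" using t(2) by (simp add: algebra_simps)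
  then have "z\<^sup>2 = 1 / complex_of_real (1 - t)" by (metis divide_divide_eq_right div_by_1 mult_1)
  also have "\<dots> = (complex_of_real x)\<^sup>2" using x(3) by (simp flip: of_real_power)
  finally have "z = of_real x \<or> z = of_real (- x)" by (simp add: power2_eq_iff)
  moreover have "x \<in> {-1..1}" "- x \<in> {-1..1}" using x by auto
  ultimately have "z \<in> complex_of_real ` {-1..1}" by blast
  then show False using assms by simp
qed

text \<open>The two preimages z (1 - s) and z (1 + s) have product 1. Off the cut the principal root
  s has positive real part, so the first has the smaller modulus; the same sign gives |1 + s| \<ge>
  1 and hence the bound 1 / |z|.\<close>

lemma inv_joukowski_slit_plane:
  assumes "z \<in> slit_plane"
  shows "inv_joukowski z \<noteq> 0" "(inv_joukowski z + 1 / inv_joukowski z) / 2 = z"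
    "norm (inv_joukowski z) < 1" "norm (inv_joukowski z) \<le> 1 / norm z"
proof -
  define s where "s = csqrt (1 - 1 / z\<^sup>2)"
  have z: "z \<noteq> 0" using slit_plane_nonzero assms by blast
  have s2: "s\<^sup>2 = 1 - 1 / z\<^sup>2" by (simp add: s_def)
  have "Re s \<noteq> 0"
  proof
    assume "Re s = 0"
    then have "s\<^sup>2 = complex_of_real (- ((Im s)\<^sup>2))" by (simp add: complex_eq_iff power2_eq_square)
    then have "1 - 1 / z\<^sup>2 = complex_of_real (- ((Im s)\<^sup>2))" using s2 by simp
    moreover have "complex_of_real (- ((Im s)\<^sup>2)) \<in> \<real>\<^sub>\<le>\<^sub>0" by (subst nonpos_Reals_of_real_iff) simp
    ultimately show False using slit_plane_branch[OF assms] by simp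
  qed
  then have s: "Re s > 0" using Re_csqrt[of "1 - 1 / z\<^sup>2"] by (simp add: s_def)
  have s1: "1 + s \<noteq> 0" using s by (auto simp: complex_eq_iff)
  have w: "inv_joukowski z = 1 / (z * (1 + s))" by (simp add: inv_joukowski_def s_def)
  show nz: "inv_joukowski z \<noteq> 0" using z s1 by (simp add: w)
  have "(z * (1 - s)) * (z * (1 + s)) = z\<^sup>2 * (1 - s\<^sup>2)" by (simp add: power2_eq_square algebra_simps)
  also have "\<dots> = 1" using z by (simp add: s2)
  finally have prod: "(z * (1 - s)) * (z * (1 + s)) = 1" .
  moreover have "z * (1 + s) \<noteq> 0" using z s1 by simp
  ultimately have w': "inv_joukowski z = z * (1 - s)"
    unfolding w by (metis nonzero_divide_eq_eq)
  have "1 / inv_joukowski z = z * (1 + s)" by (simp add: w)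
  then show "(inv_joukowski z + 1 / inv_joukowski z) / 2 = z"
    unfolding w' by (simp add: algebra_simps)
  have "(norm (1 - s))\<^sup>2 < (norm (1 + s))\<^sup>2"
    unfolding cmod_power2 using s by (simp add: power2_eq_square algebra_simps)
  then have "norm (1 - s) < norm (1 + s)" by (rule power2_less_imp_less) simp
  then have "norm (z * (1 - s)) < norm (z * (1 + s))" using z by (simp add: norm_mult)
  moreover have "norm (z * (1 - s)) * norm (z * (1 + s)) = 1" using prod by (metis norm_mult norm_one)
  ultimately have "norm (z * (1 - s)) * norm (z * (1 - s)) < 1"
    by (metis mult_strict_left_mono norm_ge_zero le_less mult_zero_left zero_neq_one)
  then have "(norm (z * (1 - s)))\<^sup>2 < 1" by (simp only: power2_eq_square)
  then show "norm (inv_joukowski z) < 1"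
    unfolding w' by (simp only: abs_square_less_1 abs_norm_cancel)
  have "1 \<le> norm (1 + s)" using complex_Re_le_cmod[of "1 + s"] s by simp
  then have "norm z * 1 \<le> norm z * norm (1 + s)" by (intro mult_left_mono) auto
  then show "norm (inv_joukowski z) \<le> 1 / norm z"
    unfolding w norm_divide norm_mult norm_one using z s1 by (intro divide_left_mono) auto
qed

lemma inv_joukowski_analytic: "inv_joukowski analytic_on slit_plane"
proof -
  have "inv_joukowski holomorphic_on slit_plane"
    unfolding inv_joukowski_def
  proof (intro holomorphic_intros)
    fix z assume z: "z \<in> slit_plane"
    show "z\<^sup>2 \<noteq> 0" using slit_plane_nonzero[OF z] by simp
    show "1 - 1 / z\<^sup>2 \<notin> \<real>\<^sub>\<le>\<^sub>0" by (rule slit_plane_branch[OF z])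
    show "z * (1 + csqrt (1 - 1 / z\<^sup>2)) \<noteq> 0"
      using inv_joukowski_slit_plane(1)[OF z] by (auto simp: inv_joukowski_def)
  qed
  then show ?thesis using open_slit_plane by (simp add: analytic_on_open)
qed

lemma inv_joukowski_at_infinity: "(inv_joukowski \<longlongrightarrow> 0) at_infinity"
proof (rule tendsto_norm_zero_cancel, rule tendsto_sandwich[of "\<lambda>_. 0"])
  have "\<forall>\<^sub>F z in at_infinity. z \<in> slit_plane"
  proof -
    have "z \<in> slit_plane" if "2 \<le> norm z" for z :: complex
      using that by auto
    then show ?thesis unfolding eventually_at_infinity by blast
  qed
  then show "\<forall>\<^sub>F z in at_infinity. norm (inv_joukowski z) \<le> 1 / norm z"
    by eventually_elim (rule inv_joukowski_slit_plane(4))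
  show "((\<lambda>z::complex. 1 / norm z) \<longlongrightarrow> 0) at_infinity"
  proof -
    have "((inverse :: complex \<Rightarrow> complex) \<longlongrightarrow> 0) at_infinity" by (rule tendsto_inverse_0)
    from tendsto_norm_zero[OF this] show ?thesis by (simp add: norm_divide inverse_eq_divide)
  qed
qed auto

text \<open>The defining formula jumps across the interval and cannot be used for boundary values.
  In terms of \<open>csqrt (1 - z\<^sup>2)\<close>, which is continuous near the open interval, the
  only ambiguity is a sign in each half plane.\<close>

lemma inv_joukowski_half_plane:
  assumes "Im z \<noteq> 0"
  shows "inv_joukowski z = z - of_real (sgn (Im z)) * \<i> * csqrt (1 - z\<^sup>2)"
proof -
  define w where "w = inv_joukowski z"
  define r where "r = csqrt (1 - z\<^sup>2)"
  have zs: "z \<in> slit_plane" using assms by auto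
  have w: "w \<noteq> 0" "(w + 1 / w) / 2 = z" "norm w < 1"
    using inv_joukowski_slit_plane[OF zs] by (simp_all add: w_def)
  have "w * w + 1 = 2 * z * w" using w(1,2) by (auto simp: field_simps)
  then have "(w - z)\<^sup>2 = z\<^sup>2 - 1" by (simp add: power2_eq_square algebra_simps)
  also have "\<dots> = (\<i> * r)\<^sup>2" by (simp add: r_def power_mult_distrib)
  finally have root: "w - z = \<i> * r \<or> w - z = - (\<i> * r)" by (simp only: power2_eq_iff)
  have Rer: "Re r \<ge> 0" unfolding r_def by (rule Re_csqrt)
  have "Im (1 / w) = - Im w / (norm w)\<^sup>2" by (simp add: Im_divide cmod_power2)
  moreover have "Im (w + 1 / w) = Im (2 * z)" using w(2) by (auto simp: mult.commute)
  ultimately have "2 * Im z = Im w - Im w / (norm w)\<^sup>2" by simp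
  \<comment> \<open>Since |w| < 1, this relation forces Im w and Im z to have opposite signs, which
    selects the root.\<close>
  then have "2 * Im z * (norm w)\<^sup>2 = - Im w * (1 - (norm w)\<^sup>2)"
    using w(1) by (simp add: field_simps)
  moreover have "1 - (norm w)\<^sup>2 > 0" using w(3) by (simp add: abs_square_less_1)
  moreover have "(norm w)\<^sup>2 > 0" using w(1) by simp
  ultimately have sign: "Im z > 0 \<Longrightarrow> Im w < 0" "Im z < 0 \<Longrightarrow> Im w > 0"
    by (smt (verit) mult_minus_left mult_pos_pos mult_nonneg_nonneg mult_neg_pos)+
  show ?thesis
  proof (cases "Im z > 0")
    case True
    have "w - z \<noteq> \<i> * r"
    proof
      assume "w - z = \<i> * r"
      then have "Im w = Im z + Re r" by (auto simp: algebra_simps complex_eq_iff)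
      then show False using sign(1)[OF True] True Rer by simp
    qed
    with root have "w - z = - (\<i> * r)" by blast
    then show ?thesis using True by (simp add: w_def r_def algebra_simps)
  next
    case False
    then have neg: "Im z < 0" using assms by simp
    have "w - z \<noteq> - (\<i> * r)"
    proof
      assume "w - z = - (\<i> * r)"
      then have "Im w = Im z - Re r" by (auto simp: algebra_simps complex_eq_iff)
      then show False using sign(2)[OF neg] neg Rer by simp
    qed
    with root have "w - z = \<i> * r" by blast
    then show ?thesis using neg by (simp add: w_def r_def algebra_simps)
  qed
qed

lemma inv_joukowski_boundary:
  assumes x: "x \<in> {-1<..<1}" and \<sigma>: "\<sigma> = 1 \<or> \<sigma> = (-1 :: real)"
  shows "((\<lambda>\<epsilon>. inv_joukowski (of_real x + of_real \<sigma> * \<i> * of_real \<epsilon>)) \<longlongrightarrow>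
      of_real x - of_real \<sigma> * \<i> * of_real (sqrt (1 - x\<^sup>2))) (at_right 0)"
proof -
  have pos: "1 - x\<^sup>2 > 0" using x by (auto simp: abs_square_less_1)
  define f where "f \<epsilon> = complex_of_real x + of_real \<sigma> * \<i> * of_real \<epsilon>" for \<epsilon> :: real
  have "(f \<longlongrightarrow> complex_of_real x + of_real \<sigma> * \<i> * of_real 0) (at_right 0)"
    unfolding f_def by (intro tendsto_intros)
  then have f: "(f \<longlongrightarrow> complex_of_real x) (at_right 0)" by simp
  have "complex_of_real 1 - (complex_of_real x)\<^sup>2 = of_real (1 - x\<^sup>2)" by simp
  then have *: "1 - (complex_of_real x)\<^sup>2 \<notin> \<real>\<^sub>\<le>\<^sub>0" using pos
    by (metis nonpos_Reals_of_real_iff not_less of_real_1)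
  have "csqrt (1 - (complex_of_real x)\<^sup>2) = of_real (sqrt (1 - x\<^sup>2))"
    using pos of_real_sqrt[of "1 - x\<^sup>2"] by simp
  moreover have "((\<lambda>\<epsilon>. csqrt (1 - (f \<epsilon>)\<^sup>2)) \<longlongrightarrow> csqrt (1 - (complex_of_real x)\<^sup>2)) (at_right 0)"
    by (rule isCont_tendsto_compose[OF continuous_at_csqrt[OF *]]) (intro tendsto_intros f)
  ultimately have "((\<lambda>\<epsilon>. f \<epsilon> - of_real \<sigma> * \<i> * csqrt (1 - (f \<epsilon>)\<^sup>2)) \<longlongrightarrow>
      of_real x - of_real \<sigma> * \<i> * of_real (sqrt (1 - x\<^sup>2))) (at_right 0)"
    by (intro tendsto_intros f) simp
  moreover have "\<forall>\<^sub>F \<epsilon> in at_right 0. f \<epsilon> - of_real \<sigma> * \<i> * csqrt (1 - (f \<epsilon>)\<^sup>2) = inv_joukowski (f \<epsilon>)"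
    unfolding eventually_at_filter
  proof (intro always_eventually allI impI)
    fix \<epsilon> :: real assume "\<epsilon> \<in> {0<..}"
    then have "sgn (Im (f \<epsilon>)) = \<sigma>" "Im (f \<epsilon>) \<noteq> 0" using \<sigma> by (auto simp: f_def)
    then show "f \<epsilon> - of_real \<sigma> * \<i> * csqrt (1 - (f \<epsilon>)\<^sup>2) = inv_joukowski (f \<epsilon>)"
      using inv_joukowski_half_plane[of "f \<epsilon>"] by simp
  qed
  ultimately show ?thesis unfolding f_def by (rule Lim_transform_eventually)
qed

lemma unit_circle_joukowski:
  assumes "norm w = 1"
  shows "(w + 1 / w) / 2 = of_real (Re w)"
proof -
  have "w * cnj w = 1" using assms by (simp flip: complex_norm_square)
  then have "1 / w = cnj w" using assms by (metis inverse_unique inverse_eq_divide)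
  then show ?thesis by (simp add: complex_add_cnj)
qed

text \<open>On the unit circle |1 - w|^2 = 2 (1 - Re w) and |1 + w|^2 = 2 (1 + Re w). The squared
  modulus therefore carries the exponents \<alpha> and \<beta> undivided, and the constant cancels
  the surplus 2^(\<alpha> + \<beta>).\<close>

definition jacobi_szego :: "real \<Rightarrow> real \<Rightarrow> complex \<Rightarrow> complex" where
  "jacobi_szego \<alpha> \<beta> w = of_real (2 powr (- (\<alpha> + \<beta>) / 2)) * (1 - w) powr of_real \<alpha> * (1 + w) powr of_real \<beta>"

lemma Re_pos_not_nonpos_Reals: "Re z > 0 \<Longrightarrow> z \<notin> \<real>\<^sub>\<le>\<^sub>0"
  by (auto simp: complex_nonpos_Reals_iff)

lemma jacobi_szego_nonzero:
  assumes "norm w < 1"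
  shows "jacobi_szego \<alpha> \<beta> w \<noteq> 0"
proof -
  have "w \<noteq> 1" "w \<noteq> -1" using assms by auto
  then show ?thesis by (auto simp: jacobi_szego_def add_eq_0_iff)
qed

text \<open>In this strip both 1 - w and 1 + w have positive real part. It contains the open disc
  and also the circle without 1 and -1, so boundary values are plain function values.\<close>

lemma jacobi_szego_analytic: "jacobi_szego \<alpha> \<beta> analytic_on {w. \<bar>Re w\<bar> < 1}"
  unfolding jacobi_szego_def
  by (intro analytic_intros) (auto intro!: Re_pos_not_nonpos_Reals)

lemma jacobi_szego_norm:
  assumes w: "norm w = 1" and x: "Re w = x" "x \<in> {-1<..<1}"
  shows "(norm (jacobi_szego \<alpha> \<beta> w))\<^sup>2 = (1 - x) powr \<alpha> * (1 + x) powr \<beta>"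
proof -
  have im: "(Im w)\<^sup>2 = 1 - x\<^sup>2" using w x(1) cmod_power2[of w] by simp
  have n1: "(norm (1 - w))\<^sup>2 = 2 * (1 - x)" and n2: "(norm (1 + w))\<^sup>2 = 2 * (1 + x)"
    unfolding cmod_power2 using im x(1) by (simp_all add: power2_eq_square algebra_simps)
  have pw: "(y powr a)\<^sup>2 = (y\<^sup>2) powr a" if "y \<ge> 0" for y a :: real
    using that by (simp add: power2_eq_square powr_mult)
  have "(norm (jacobi_szego \<alpha> \<beta> w))\<^sup>2 =
     (2 powr (- (\<alpha> + \<beta>) / 2))\<^sup>2 * (norm (1 - w) powr \<alpha>)\<^sup>2 * (norm (1 + w) powr \<beta>)\<^sup>2"
    by (simp add: jacobi_szego_def norm_mult norm_powr_real_powr' power_mult_distrib)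
  also have "(2 powr (- (\<alpha> + \<beta>) / 2))\<^sup>2 = 2 powr (- \<alpha>) * (2::real) powr (- \<beta>)"
    by (simp add: power2_eq_square flip: powr_add)
  also have "2 powr (- \<alpha>) * 2 powr (- \<beta>) * (norm (1 - w) powr \<alpha>)\<^sup>2 * (norm (1 + w) powr \<beta>)\<^sup>2
      = 2 powr (- \<alpha>) * 2 powr (- \<beta>) * (2 * (1 - x)) powr \<alpha> * (2 * (1 + x)) powr \<beta>"
    by (simp add: pw n1 n2)
  also have "\<dots> = (1 - x) powr \<alpha> * (1 + x) powr \<beta>"
  proof -
    have "(2 * (1 - x)) powr \<alpha> = 2 powr \<alpha> * (1 - x) powr \<alpha>" "(2 * (1 + x)) powr \<beta> = 2 powr \<beta> * (1 + x) powr \<beta>"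
      by (intro powr_mult; use x(2) in simp)+
    then show ?thesis by (simp add: powr_minus field_simps del: distrib_left_numeral right_diff_distrib_numeral)
  qed
  finally show ?thesis .
qed

section \<open>Assembly of the matrix Szego function on the slit plane\<close>

theorem proposition1p4:
  fixes H :: "real \<Rightarrow> complex^'r^'r" and \<alpha> \<beta> :: real
  assumes "\<alpha> > -1" and "\<beta> > -1"
    and "\<forall>x\<in>{-1<..<1}. pos_def_mat (H x)"
    and "real_analytic_mat_on_interval H"
    and "H 1 \<noteq> 0" and "H (-1) \<noteq> 0"
  shows "\<exists>D :: complex \<Rightarrow> complex^'r^'r.
           mat_analytic_on D (- (complex_of_real ` {-1..1})) \<and>
           (\<forall>z\<in>- (complex_of_real ` {-1..1}). invertible (D z)) \<and>
           (\<exists>Dinf. (D \<longlongrightarrow> Dinf) at_infinity \<and> invertible Dinf) \<and>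
           (\<exists>Dp Dm. \<forall>x\<in>{-1<..<1::real}.
              ((\<lambda>\<epsilon>. D (complex_of_real x + \<i> * complex_of_real \<epsilon>)) \<longlongrightarrow> Dp x) (at_right 0) \<and>
              ((\<lambda>\<epsilon>. D (complex_of_real x - \<i> * complex_of_real \<epsilon>)) \<longlongrightarrow> Dm x) (at_right 0) \<and>
              ((1 - x) powr \<alpha> * (1 + x) powr \<beta>) *\<^sub>R H x = Dm x ** cadjoint (Dm x) \<and>
              ((1 - x) powr \<alpha> * (1 + x) powr \<beta>) *\<^sub>R H x = Dp x ** cadjoint (Dp x))"
proof -
  obtain U G where U: "open U" "complex_of_real ` {-1..1} \<subseteq> U" and G: "mat_analytic_on G U"
    and GH: "\<And>x. x \<in> {-1..1} \<Longrightarrow> G (complex_of_real x) = H x"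
    using assms(4) unfolding real_analytic_mat_on_interval_def by blast
  \<comment> \<open>The Joukowski map folds the circle onto [-1,1], so analyticity of H on the
    closed interval gives an analytic symbol on the whole circle, the points 1 and -1
    included.\<close>
  define F where "F w = G ((w + 1 / w) / 2)" for w
  have Re_circle: "Re w \<in> {-1..1}" if "norm w = 1" for w
    using abs_Re_le_cmod[of w] that by auto
  have FH: "F w = H (Re w)" if "norm w = 1" for w
    unfolding F_def unit_circle_joukowski[OF that] by (rule GH[OF Re_circle[OF that]])
  have F: "mat_analytic_on F (sphere 0 1)"
    unfolding mat_analytic_on_def
  proof (intro allI)
    fix i j
    have "(\<lambda>w. (w + 1 / w) / 2) analytic_on sphere 0 1" by (intro analytic_intros) auto
    moreover have "(\<lambda>z. G z $ i $ j) analytic_on (\<lambda>w. (w + 1 / w) / 2) ` sphere 0 1"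
    proof (rule analytic_on_subset)
      show "(\<lambda>z. G z $ i $ j) analytic_on U" using G by (simp add: mat_analytic_on_def)
      show "(\<lambda>w. (w + 1 / w) / 2) ` sphere 0 1 \<subseteq> U"
        using U(2) Re_circle by (auto simp: unit_circle_joukowski)
    qed
    ultimately show "(\<lambda>w. F w $ i $ j) analytic_on sphere 0 1"
      using analytic_on_compose unfolding F_def o_def by fast
  qed
  have Re_inner: "Re w \<in> {-1<..<1}" if "norm w = 1" "w \<noteq> 1" "w \<noteq> -1" for w
  proof -
    have "(Re w)\<^sup>2 + (Im w)\<^sup>2 = 1" using that(1) by (simp flip: cmod_power2)
    then have "Re w \<noteq> 1" "Re w \<noteq> -1" using that(2,3) by (auto simp: complex_eq_iff)
    then show ?thesis using Re_circle[OF that(1)] by auto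
  qed
  have pd: "psd (F w)" "det (F w) \<noteq> 0" if "norm w = 1" "w \<notin> {1, -1}" for w
    using pos_def_mat_imp_psd[of "H (Re w)"] assms(3) Re_inner[of w] that FH[of w] by (auto simp: invertible_det_nz)
  have psdF: "psd (F w)" if w: "norm w = 1" for w
  proof (rule psd_limit[of F])
    show "(F \<longlongrightarrow> F w) (at w within sphere 0 1)"
      using mat_analytic_on_imp_continuous_on[OF F] w by (simp add: continuous_on_def)
    \<comment> \<open>If w is itself 1 or -1, only the other exceptional point has to be avoided,
      because the punctured neighbourhood already omits w.\<close>
    have "\<forall>\<^sub>F u in at w within sphere 0 1. u \<notin> {1, -1} - {w}"
    proof -
      have "open (- ({1, -1} - {w}))" by (intro open_Compl finite_imp_closed) auto
      from eventually_at_in_open'[OF this, of w] have "\<forall>\<^sub>F u in at w. u \<in> - ({1, -1} - {w})" by simp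
      then have "\<forall>\<^sub>F u in at w. u \<notin> {1, -1} - {w}" by (rule eventually_mono) blast
      then show ?thesis by (rule filter_leD[OF at_le, rotated]) simp
    qed
    moreover have "\<forall>\<^sub>F u in at w within sphere 0 1. u \<noteq> w \<and> norm u = 1"
      by (auto simp: eventually_at_filter)
    ultimately show "\<forall>\<^sub>F u in at w within sphere 0 1. psd (F u)"
      by eventually_elim (use pd(1) in auto)
  qed (rule at_within_circle_nontrivial(1)[OF w])
  obtain S :: "complex \<Rightarrow> complex^'r^'r" where S: "mat_analytic_on S (cball 0 1)"
    and Sinv: "\<And>w. w \<in> ball 0 1 \<Longrightarrow> invertible (S w)"
    and SF: "\<And>w. w \<in> sphere 0 1 \<Longrightarrow> F w = S w ** cadjoint (S w)"
    using psd_circle_factorization[of "{1, -1}" F] F psdF pd(2) by auto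
  \<comment> \<open>The scalar factor is written as a diagonal matrix so that invertibility and the
    adjoint follow from the matrix lemmas.\<close>
  define E where "E w = dmat (\<lambda>_. jacobi_szego \<alpha> \<beta> w) ** S w" for w
  define D where "D z = E (inv_joukowski z)" for z
  have Eij: "E w $ i $ j = jacobi_szego \<alpha> \<beta> w * S w $ i $ j" for w i j
    by (simp add: E_def dmat_mult_left)
  have dom: "w \<in> {w. \<bar>Re w\<bar> < 1}" if "norm w < 1" for w
    using abs_Re_le_cmod[of w] that by auto
  have Einv: "invertible (E w)" if "norm w < 1" for w
    unfolding E_def using that jacobi_szego_nonzero[OF that]
    by (intro invertible_mult Sinv) (auto simp: invertible_det_nz det_dmat)
  have "mat_analytic_on D slit_plane"
    unfolding mat_analytic_on_def
  proof (intro allI)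
    fix i j
    have img: "inv_joukowski ` slit_plane \<subseteq> ball 0 1" using inv_joukowski_slit_plane(3) by auto
    have "(\<lambda>w. E w $ i $ j) analytic_on ball 0 1"
      unfolding Eij
    proof (intro analytic_on_mult)
      show "jacobi_szego \<alpha> \<beta> analytic_on ball 0 1"
        by (rule analytic_on_subset[OF jacobi_szego_analytic]) (use dom in auto)
      show "(\<lambda>w. S w $ i $ j) analytic_on ball 0 1"
        by (rule analytic_on_subset[of _ "cball 0 1"]) (use S in \<open>auto simp: mat_analytic_on_def\<close>)
    qed
    from analytic_on_compose[OF inv_joukowski_analytic analytic_on_subset[OF this img]]
    show "(\<lambda>z. D z $ i $ j) analytic_on slit_plane" by (simp add: D_def o_def)
  qed
  moreover have "\<forall>z\<in>slit_plane. invertible (D z)"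
    unfolding D_def using Einv inv_joukowski_slit_plane(3) by blast
  \<comment> \<open>This set contains the open disc together with the two open boundary arcs, so a
    single continuity statement serves the limit at infinity and both boundary limits.\<close>
  moreover have contE: "continuous_on {w. norm w \<le> 1 \<and> \<bar>Re w\<bar> < 1} E"
  proof (rule continuous_on_matrix, unfold Eij, intro continuous_on_mult)
    show "continuous_on {w. norm w \<le> 1 \<and> \<bar>Re w\<bar> < 1} (jacobi_szego \<alpha> \<beta>)"
      by (rule continuous_on_subset[OF holomorphic_on_imp_continuous_on[OF analytic_imp_holomorphic[OF jacobi_szego_analytic]]]) auto
    show "continuous_on {w. norm w \<le> 1 \<and> \<bar>Re w\<bar> < 1} (\<lambda>w. S w $ i $ j)" for i j
      by (rule continuous_on_subset[OF continuous_on_component[OF continuous_on_component[OF mat_analytic_on_imp_continuous_on[OF S]]]]) auto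
  qed
  moreover have "(D \<longlongrightarrow> E 0) at_infinity"
    unfolding D_def
  proof (rule continuous_on_tendsto_compose[OF contE inv_joukowski_at_infinity])
    have "\<forall>\<^sub>F z in at_infinity. norm (inv_joukowski z) < 1"
      using tendstoD[OF inv_joukowski_at_infinity, of 1] by simp
    then show "\<forall>\<^sub>F z in at_infinity. inv_joukowski z \<in> {w. norm w \<le> 1 \<and> \<bar>Re w\<bar> < 1}"
      by eventually_elim (use dom in auto)
  qed simp
  moreover have "invertible (E 0)" by (rule Einv) simp
  \<comment> \<open>The sign \<sigma> treats both sides of the cut at once: \<sigma> = 1 is the
    approach from above, and its boundary point lies on the lower arc. \<open>W\<close> is bound by
    an equation only to abbreviate that point, and \<open>refl\<close> discharges it
    afterwards.\<close>
  moreover have "((\<lambda>\<epsilon>. D (of_real x + of_real \<sigma> * \<i> * of_real \<epsilon>)) \<longlongrightarrow> E (W \<sigma> x)) (at_right 0) \<and>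
      ((1 - x) powr \<alpha> * (1 + x) powr \<beta>) *\<^sub>R H x = E (W \<sigma> x) ** cadjoint (E (W \<sigma> x))"
    if x: "x \<in> {-1<..<1}" and \<sigma>: "\<sigma> = 1 \<or> \<sigma> = -1"
      and W: "W = (\<lambda>\<sigma> x. of_real x - of_real \<sigma> * \<i> * of_real (sqrt (1 - x\<^sup>2)))"
    for x \<sigma> :: real and W
  proof
    have x2: "1 - x\<^sup>2 \<ge> 0" using x by (auto simp: abs_square_le_1)
    have ReW: "Re (W \<sigma> x) = x" by (simp add: W)
    have "(norm (W \<sigma> x))\<^sup>2 = 1"
      unfolding cmod_power2 using \<sigma> x2 by (auto simp: W)
    then have nW: "norm (W \<sigma> x) = 1" by (simp add: power2_eq_1_iff) (metis norm_ge_zero not_one_le_zero neg_0_le_iff_le)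
    show "((\<lambda>\<epsilon>. D (of_real x + of_real \<sigma> * \<i> * of_real \<epsilon>)) \<longlongrightarrow> E (W \<sigma> x)) (at_right 0)"
      unfolding D_def
    proof (rule continuous_on_tendsto_compose[OF contE])
      show "((\<lambda>\<epsilon>. inv_joukowski (of_real x + of_real \<sigma> * \<i> * of_real \<epsilon>)) \<longlongrightarrow> W \<sigma> x) (at_right 0)"
        unfolding W by (rule inv_joukowski_boundary[OF x \<sigma>])
      show "W \<sigma> x \<in> {w. norm w \<le> 1 \<and> \<bar>Re w\<bar> < 1}" using nW ReW x by auto
      show "\<forall>\<^sub>F \<epsilon> in at_right 0. inv_joukowski (of_real x + of_real \<sigma> * \<i> * of_real \<epsilon>) \<in> {w. norm w \<le> 1 \<and> \<bar>Re w\<bar> < 1}"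
        unfolding eventually_at_filter
      proof (intro always_eventually allI impI)
        fix \<epsilon> :: real assume "\<epsilon> \<in> {0<..}"
        then have "Im (of_real x + of_real \<sigma> * \<i> * of_real \<epsilon>) \<noteq> 0" using \<sigma> by auto
        then have "of_real x + of_real \<sigma> * \<i> * of_real \<epsilon> \<in> slit_plane" by force
        from inv_joukowski_slit_plane(3)[OF this]
        show "inv_joukowski (of_real x + of_real \<sigma> * \<i> * of_real \<epsilon>) \<in> {w. norm w \<le> 1 \<and> \<bar>Re w\<bar> < 1}"
          using dom by auto
      qed
    qed
    have "E w ** cadjoint (E w) = (norm (jacobi_szego \<alpha> \<beta> w))\<^sup>2 *\<^sub>R (S w ** cadjoint (S w))" for w
    proof -
      have "E w ** cadjoint (E w) = dmat (\<lambda>_. jacobi_szego \<alpha> \<beta> w) ** (S w ** cadjoint (S w)) ** cadjoint (dmat (\<lambda>_. jacobi_szego \<alpha> \<beta> w))"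
        by (simp add: E_def cadjoint_mult matrix_mul_assoc)
      then have "(E w ** cadjoint (E w)) $ i $ j = jacobi_szego \<alpha> \<beta> w * cnj (jacobi_szego \<alpha> \<beta> w) * (S w ** cadjoint (S w)) $ i $ j" for i j
        by (simp add: dmat_mult_left dmat_mult_cadjoint_right mult_ac)
      then show ?thesis
        by (simp add: vec_eq_iff scaleR_conv_of_real[where 'a = complex] complex_norm_square del: of_real_power)
    qed
    then show "((1 - x) powr \<alpha> * (1 + x) powr \<beta>) *\<^sub>R H x = E (W \<sigma> x) ** cadjoint (E (W \<sigma> x))"
      using SF[of "W \<sigma> x"] FH[OF nW] nW ReW jacobi_szego_norm[OF nW ReW x] by simp
  qed
  note boundary = this[OF _ _ refl]
  ultimately show ?thesis
    using boundary[of _ 1] boundary[of _ "-1"]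
    \<comment> \<open>The upper boundary value comes first. The factors 1 and -1 are left
      unsimplified in the witnesses so that they match the instances of
      \<open>boundary\<close>.\<close>
    by (intro exI[of _ D] conjI exI[of _ "E 0"]
          exI[of _ "\<lambda>x. E (of_real x - of_real 1 * \<i> * of_real (sqrt (1 - x\<^sup>2)))"]
          exI[of _ "\<lambda>x. E (of_real x - of_real (- 1) * \<i> * of_real (sqrt (1 - x\<^sup>2)))"] ballI) simp_all
qed

end
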